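(* Consider the SUPER-ADAM algorithm with $\tau=0$ applied to $\min_{x\in\mathcal{X}} f(x)=\mathbb{E}_{\xi\sim\mathcal{D}}[f(x;\xi)]$, where $\mathcal{X}\subset\mathbb{R}^d$ is a nonempty compact convex set. Assume: (1) there is $\sigma>0$ such that for all $x\in\mathcal{X}$, $\mathbb{E}[\nabla f(x;\xi)]=\nabla f(x)$ and $\mathbb{E}\|\nabla f(x;\xi)-\nabla f(x)\|^2\le\sigma^2$; (2) $f$ is bounded below on $\mathcal{X}$, with $f^*=\inf_{x\in\mathcal{X}}f(x)>-\infty$; (3) there is $\rho>0$ such that $H_t\succeq\rho I_d$ for all $t\ge1$; (4) there is $L>0$ such that $\|\nabla f(x)-\nabla f(y)\|\le L\|x-y\|$ for all $x,y\in\mathcal{X}$. Let $k>0$, $m\ge k^2$, $0<\gamma\le\frac{\rho m^{1/2}}{8Lk}$, $\frac{8L\gamma}{\rho}\le c\le\frac{m^{1/2}}{k}$, and for all $t\ge0$ let $\mu_t=\frac{k}{(m+t)^{1/2}}$ and $\alpha_{t+1}=c\mu_t$. Then for every integer $T\ge1$, $$\frac1T\sum_{t=1}^T\mathbb{E}\|\mathcal{G}_{\mathcal{X}}(x_t,\nabla f(x_t),\gamma)\|\le\frac1T\sum_{t=1}^T\mathbb{E}[\mathcal{M}_t]\le\frac{2\sqrt{2M}\,m^{1/4}}{T^{1/2}}+\frac{2\sqrt{2M}}{T^{1/4}},$$ where $M=\frac{f(x_1)-f^*}{\rho\gamma k}+\frac{2\sigma^2}{\rho\gamma kL}+\frac{2m\sigma^2}{\rho\gamma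 kL}\ln(m+T)$.
   Context: Norms: $\|\cdot\|$ is the $\ell_2$ norm for vectors and the spectral norm for matrices. $f(\cdot;\xi)$ and $f$ are differentiable (on an open set containing $\mathcal{X}$), and $f$ may be nonconvex; gradients are with respect to $x$. SUPER-ADAM algorithm. Inputs: $\tau\in\{0,1\}$, constant $\gamma>0$, parameters $\mu_t\in(0,1]$, $\alpha_{t+1}\in(0,1]$, and a deterministic starting point $x_1\in\mathcal{X}$. The samples $\xi_1,\xi_2,\dots$ are drawn independently from $\mathcal{D}$. Set $g_1=\nabla f(x_1;\xi_1)$. For $t=1,2,\dots$: (i) generate a symmetric matrix $H_t\in\mathbb{R}^{d\times d}$ by any rule depending (measurably) only on the information available so far, i.e. on $\xi_1,\dots,\xi_t$; (ii) $\tilde{x}_{t+1}=\arg\min_{x\in\mathcal{X}}\{\langle g_t,x\rangle+\frac{1}{2\gamma}(x-x_t)^TH_t(x-x_t)\}$; (iii) $x_{t+1}=(1-\mu_t)x_t+\mu_t\tilde{x}_{t+1}$; (iv) draw $\xi_{t+1}$ and set $g_{t+1}=\alpha_{t+1}\nabla f(x_{t+1};\xi_{t+1})+(1-\alpha_{t+1})\big[g_t+\tau\big(\nabla f(x_{t+1};\xi_{t+1})-\nabla f(x_t;\xi_{t+1})\big)\big]$ (so for $\tau=0$, $g_{t+1}=\alpha_{t+1}\nabla f(x_{t+1};\xi_{t+1})+(1-\alpha_{t+1})g_t$). Convergence measure: $\mathcal{M}_t=\frac1\rho\|\nabla f(x_t)-g_t\|+\frac1\gamma\|\tilde{x}_{t+1}-x_t\|$.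 Gradient mapping: $\mathcal{G}_{\mathcal{X}}(x_t,\nabla f(x_t),\gamma)=\frac1\gamma(x_t-x_{t+1}^+)$, where $x_{t+1}^+=\arg\min_{x\in\mathcal{X}}\{\langle\nabla f(x_t),x\rangle+\frac{1}{2\gamma}(x-x_t)^TH_t(x-x_t)\}$. $\mathbb{E}$ denotes expectation over all the samples. *)

theory Defs
  imports "HOL-Probability.Probability"
begin

definition gradient :: "('a::real_inner \<Rightarrow> real) \<Rightarrow> 'a \<Rightarrow> 'a" where
  "gradient f x = (THE D. GDERIV f x :> D)"

definition pos_semidef :: "real^'n^'n \<Rightarrow> bool" where
  "pos_semidef A \<longleftrightarrow> transpose A = A \<and> (\<forall>v. 0 \<le> v \<bullet> (A *v v))"

definition loewner_le :: "real^'n^'n \<Rightarrow> real^'n^'n \<Rightarrow> bool"  (infix \<open>\<preceq>\<^sub>L\<close> 50) where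
  "A \<preceq>\<^sub>L B \<longleftrightarrow> pos_semidef (B - A)"

definition prox_objective ::
    "real \<Rightarrow> real^'n^'n \<Rightarrow> real^'n \<Rightarrow> real^'n \<Rightarrow> real^'n \<Rightarrow> real" where
  "prox_objective \<gamma> H y v x = v \<bullet> x + 1 / (2 * \<gamma>) * ((x - y) \<bullet> (H *v (x - y)))"

(* The minimizer exists and is unique when X is nonempty, compact and convex, \<gamma> > 0 and H is
   positive definite; only then is the choice made by arg_min_on determined. *)
definition prox_step ::
    "(real^'n) set \<Rightarrow> real \<Rightarrow> real^'n^'n \<Rightarrow> real^'n \<Rightarrow> real^'n \<Rightarrow> real^'n" where
  "prox_step X \<gamma> H y v = arg_min_on (prox_objective \<gamma> H y v) X"

definition gradient_mapping ::
    "(real^'n) set \<Rightarrow> real^'n^'n \<Rightarrow> real^'n \<Rightarrow> real^'n \<Rightarrow> real \<Rightarrow> real^'n" where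
  "gradient_mapping X H x v \<gamma> = (1 / \<gamma>) *\<^sub>R (x - prox_step X \<gamma> H x v)"

(* One sample path of the algorithm: s t is the t-th sample, F x s the sampled loss, and
   x, xt, g are the iterates, the minimizers of the subproblems and the gradient estimates.
   All sequences are indexed from t = 1 (xt from t = 2). The rule producing the matrices
   H t from the samples is not part of this predicate. *)
definition super_adam_path ::
    "real \<Rightarrow> (real^'n) set \<Rightarrow> (real^'n \<Rightarrow> 's \<Rightarrow> real) \<Rightarrow> real \<Rightarrow> (nat \<Rightarrow> real) \<Rightarrow> (nat \<Rightarrow> real) \<Rightarrow> real^'n
     \<Rightarrow> (nat \<Rightarrow> 's) \<Rightarrow> (nat \<Rightarrow> real^'n^'n)
     \<Rightarrow> (nat \<Rightarrow> real^'n) \<Rightarrow> (nat \<Rightarrow> real^'n) \<Rightarrow> (nat \<Rightarrow> real^'n) \<Rightarrow> bool" where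
  "super_adam_path \<tau> X F \<gamma> \<mu> \<alpha> x1 s H x xt g \<longleftrightarrow>
     \<tau> \<in> {0, 1} \<and> 0 < \<gamma> \<and> x1 \<in> X \<and>
     (\<forall>t\<ge>1. \<mu> t \<in> {0<..1} \<and> \<alpha> (t + 1) \<in> {0<..1}) \<and>
     x 1 = x1 \<and>
     g 1 = gradient (\<lambda>y. F y (s 1)) x1 \<and>
     (\<forall>t\<ge>1.
        transpose (H t) = H t \<and>
        xt (t + 1) = prox_step X \<gamma> (H t) (x t) (g t) \<and>
        x (t + 1) = (1 - \<mu> t) *\<^sub>R x t + \<mu> t *\<^sub>R xt (t + 1) \<and>
        g (t + 1) =
          \<alpha> (t + 1) *\<^sub>R gradient (\<lambda>y. F y (s (t + 1))) (x (t + 1)) +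
          (1 - \<alpha> (t + 1)) *\<^sub>R
            (g t + \<tau> *\<^sub>R (gradient (\<lambda>y. F y (s (t + 1))) (x (t + 1)) -
                        gradient (\<lambda>y. F y (s (t + 1))) (x t))))"

definition convergence_measure ::
    "real \<Rightarrow> real \<Rightarrow> (real^'n \<Rightarrow> real) \<Rightarrow> real^'n \<Rightarrow> real^'n \<Rightarrow> real^'n \<Rightarrow> real" where
  "convergence_measure \<rho> \<gamma> f x g xt' =
     1 / \<rho> * norm (gradient f x - g) + 1 / \<gamma> * norm (xt' - x)"

end

theory Submission
  imports Defs
begin

text \<open>Write \<open>e\<^sub>t = g\<^sub>t - \<nabla>f(x\<^sub>t)\<close> and \<open>d\<^sub>t = xt\<^sub>t\<^sub>+\<^sub>1 - x\<^sub>t\<close>. Smoothness of \<open>f\<close> and the optimality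
  condition of the proximal step bound \<open>f(x\<^sub>t\<^sub>+\<^sub>1) - f(x\<^sub>t)\<close> by
  \<open>\<mu>\<^sub>t (\<gamma>/\<rho> |e\<^sub>t|\<^sup>2 - 11/16 \<rho>/\<gamma> |d\<^sub>t|\<^sup>2)\<close>. The fresh sample is independent of the past, so its noise has
  no cross term and \<open>E|e\<^sub>t\<^sub>+\<^sub>1|\<^sup>2 \<le> (1 - c\<mu>\<^sub>t) E|e\<^sub>t|\<^sup>2 + L\<^sup>2\<mu>\<^sub>t/c E|d\<^sub>t|\<^sup>2 + (c\<mu>\<^sub>t)\<^sup>2\<sigma>\<^sup>2\<close>. The condition
  \<open>c \<ge> 8L\<gamma>/\<rho>\<close> makes the potential \<open>f(x\<^sub>t) + |e\<^sub>t|\<^sup>2/(4L)\<close> decrease up to noise terms, and since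
  \<open>(c\<mu>\<^sub>t)\<^sup>2 \<le> m/(m + t)\<close> these sum to a logarithm. Cauchy--Schwarz turns the resulting bound on
  \<open>\<Sum> E|e\<^sub>t|\<^sup>2/\<rho>\<^sup>2 + E|d\<^sub>t|\<^sup>2/\<gamma>\<^sup>2\<close> into the rate.\<close>

section \<open>Gradients\<close>

text \<open>Justifies the definite description in \<open>gradient\<close>: the vector
  \<open>d\<close> of the values of the derivative on the basis represents it, and uniqueness of
  derivatives excludes any other vector.\<close>

lemma gradient_GDERIV:
  fixes f :: "'a::euclidean_space \<Rightarrow> real"
  assumes "f differentiable (at x)"
  shows "GDERIV f x :> gradient f x"
proof -
  obtain f' where f': "(f has_derivative f') (at x)"
    using assms by (auto simp: differentiable_def)
  then interpret bounded_linear f' by (rule has_derivative_bounded_linear)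
  define d where "d = (\<Sum>b\<in>Basis. f' b *\<^sub>R b)"
  have "f' v = v \<bullet> d" for v
  proof -
    have "f' v = f' (\<Sum>b\<in>Basis. (v \<bullet> b) *\<^sub>R b)" by (simp add: euclidean_representation)
    also have "\<dots> = v \<bullet> d"
      by (simp add: sum scaleR d_def inner_sum_right mult.commute)
    finally show ?thesis .
  qed
  then have "f' = (\<lambda>v. v \<bullet> d)" by auto
  with f' have d: "GDERIV f x :> d" by (simp add: gderiv_def)
  have "e = d" if "GDERIV f x :> e" for e
  proof -
    have "(\<lambda>h. h \<bullet> e) = (\<lambda>h. h \<bullet> d)"
      using that d unfolding gderiv_def by (rule has_derivative_unique)
    then show ?thesis by (simp add: fun_eq_iff vector_eq_ldot)
  qed
  with d show ?thesis unfolding gradient_def by (rule theI)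
qed

lemma gradient_has_derivative:
  fixes f :: "'a::euclidean_space \<Rightarrow> real"
  assumes "f differentiable_on U" "open U" "x \<in> U"
  shows "(f has_derivative (\<lambda>h. h \<bullet> gradient f x)) (at x)"
  using gradient_GDERIV[of f x] assms
  by (simp add: gderiv_def differentiable_on_eq_differentiable_at)

text \<open>Expresses a component of the gradient as a limit of a sequence of function values, so
  that measurability of the sampled losses can be passed on to their gradients.\<close>

lemma directional_difference_quotient:
  fixes f :: "'a::euclidean_space \<Rightarrow> real"
  assumes "f differentiable_on U" "open U" "x \<in> U"
  shows "(\<lambda>n. real (Suc n) * (f (x + (1 / real (Suc n)) *\<^sub>R b) - f x)) \<longlonglongrightarrow> gradient f x \<bullet> b"
proof -
  have "((\<lambda>t. f (x + t *\<^sub>R b)) has_derivative (\<lambda>t. (t *\<^sub>R b) \<bullet> gradient f x)) (at 0)"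
    by (rule has_derivative_compose[of "\<lambda>t. x + t *\<^sub>R b" "\<lambda>t. t *\<^sub>R b" 0 UNIV f])
       (auto intro!: derivative_eq_intros gradient_has_derivative[OF assms])
  then have "((\<lambda>t. f (x + t *\<^sub>R b)) has_real_derivative (gradient f x \<bullet> b)) (at 0)"
    by (simp add: has_field_derivative_def inner_commute mult.commute[of "gradient f x \<bullet> b"] mult_commute_abs)
  then have "((\<lambda>h. (f (x + h *\<^sub>R b) - f x) / h) \<longlongrightarrow> gradient f x \<bullet> b) (at 0)"
    by (simp add: DERIV_def)
  moreover have "filterlim (\<lambda>n. 1 / real (Suc n)) (at 0) sequentially"
    using LIMSEQ_inverse_real_of_nat
    by (auto simp: filterlim_at inverse_eq_divide)
  ultimately have "(\<lambda>n. (f (x + (1 / real (Suc n)) *\<^sub>R b) - f x) / (1 / real (Suc n))) \<longlonglongrightarrow> gradient f x \<bullet> b"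
    by (rule filterlim_compose)
  then show ?thesis by (simp add: mult.commute)
qed

text \<open>The descent lemma. By convexity the segment from \<open>x\<close> to \<open>y\<close>
  stays in \<open>X\<close>, where the gradient is Lipschitz; along it the gap \<open>q\<close>
  between \<open>f\<close> and its quadratic majorant has nonpositive derivative by
  Cauchy-Schwarz.\<close>

lemma smooth_upper_bound:
  fixes f :: "'a::euclidean_space \<Rightarrow> real"
  assumes f: "f differentiable_on U" "open U" and X: "convex X" "X \<subseteq> U" "x \<in> X" "y \<in> X"
    and smooth: "\<And>y z. y \<in> X \<Longrightarrow> z \<in> X \<Longrightarrow> norm (gradient f y - gradient f z) \<le> L * norm (y - z)"
  shows "f y \<le> f x + gradient f x \<bullet> (y - x) + L / 2 * (norm (y - x))\<^sup>2"
proof -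
  define p where "p = (\<lambda>t. x + t *\<^sub>R (y - x))"
  define q where "q = (\<lambda>t. f (p t) - t * (gradient f x \<bullet> (y - x)) - L * t\<^sup>2 / 2 * (norm (y - x))\<^sup>2)"
  have "q 1 \<le> q 0"
  proof (rule DERIV_nonpos_imp_nonincreasing[of 0 1 q])
    fix t :: real assume t: "0 \<le> t" "t \<le> 1"
    have "p t = (1 - t) *\<^sub>R x + t *\<^sub>R y" by (simp add: p_def algebra_simps)
    then have pX: "p t \<in> X" using X t by (simp add: convexD)
    have "((\<lambda>t. f (p t)) has_derivative (\<lambda>s. (s *\<^sub>R (y - x)) \<bullet> gradient f (p t))) (at t)"
      by (rule has_derivative_compose[of p "\<lambda>s. s *\<^sub>R (y - x)" t UNIV f])
         (use pX X in \<open>auto simp: p_def intro!: derivative_eq_intros gradient_has_derivative[OF f]\<close>)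
    then have "((\<lambda>t. f (p t)) has_real_derivative ((y - x) \<bullet> gradient f (p t))) (at t)"
      by (simp add: has_field_derivative_def mult_commute_abs)
    then have "(q has_real_derivative ((y - x) \<bullet> gradient f (p t) - gradient f x \<bullet> (y - x)
        - L * t * (norm (y - x))\<^sup>2)) (at t)"
      unfolding q_def by (auto intro!: derivative_eq_intros)
    moreover have "(y - x) \<bullet> gradient f (p t) - gradient f x \<bullet> (y - x) \<le> L * t * (norm (y - x))\<^sup>2"
    proof -
      have "(y - x) \<bullet> gradient f (p t) - gradient f x \<bullet> (y - x) = (gradient f (p t) - gradient f x) \<bullet> (y - x)"
        by (simp add: inner_diff_left inner_diff_right inner_commute)
      also have "\<dots> \<le> norm (gradient f (p t) - gradient f x) * norm (y - x)"
        by (rule norm_cauchy_schwarz)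
      also have "\<dots> \<le> (L * norm (p t - x)) * norm (y - x)"
        by (intro mult_right_mono smooth pX X) auto
      also have "\<dots> = L * t * (norm (y - x))\<^sup>2"
        using t by (simp add: p_def power2_eq_square)
      finally show ?thesis .
    qed
    ultimately show "\<exists>d. (q has_real_derivative d) (at t) \<and> d \<le> 0" by fastforce
  qed simp
  then show ?thesis by (simp add: q_def p_def)
qed

section \<open>The proximal step\<close>

lemma loewner_ge_quadratic:
  fixes H :: "real^'n^'n"
  assumes "\<rho> *\<^sub>R mat 1 \<preceq>\<^sub>L H"
  shows "\<rho> * (norm v)\<^sup>2 \<le> v \<bullet> (H *v v)"
proof -
  have "0 \<le> v \<bullet> ((H - \<rho> *\<^sub>R mat 1) *v v)"
    using assms by (simp add: loewner_le_def pos_semidef_def)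
  then show ?thesis
    by (simp add: matrix_vector_mult_diff_rdistrib inner_diff_right scaleR_matrix_vector_assoc[symmetric]
        power2_norm_eq_inner)
qed

lemma continuous_on_matrix_vector_mult [continuous_intros]:
  fixes A :: "'a::topological_space \<Rightarrow> real^'n^'m"
  assumes "continuous_on S A" "continuous_on S u"
  shows "continuous_on S (\<lambda>p. A p *v u p)"
  unfolding matrix_vector_mult_def using assms by (auto intro!: continuous_intros)

text \<open>The exact second-order Taylor expansion of the quadratic objective. Symmetry of
  \<open>H\<close> merges the two cross terms into one gradient term.\<close>

lemma prox_objective_expand:
  fixes H :: "real^'n^'n"
  assumes "transpose H = H"
  shows "prox_objective \<gamma> H y v (a + u)
    = prox_objective \<gamma> H y v a + (v + (1 / \<gamma>) *\<^sub>R (H *v (a - y))) \<bullet> u + 1 / (2 * \<gamma>) * (u \<bullet> (H *v u))"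
proof -
  define w where "w = a - y"
  have "w \<bullet> (H *v u) = (H *v w) \<bullet> u"
    by (metis assms dot_lmul_matrix vector_transpose_matrix)
  then have "(w + u) \<bullet> (H *v (w + u)) = w \<bullet> (H *v w) + 2 * ((H *v w) \<bullet> u) + u \<bullet> (H *v u)"
    by (simp add: matrix_vector_right_distrib inner_add_left inner_add_right inner_commute[of u "H *v w"])
  moreover have w: "a + u - y = w + u" by (simp add: w_def)
  ultimately show ?thesis
    unfolding prox_objective_def w_def[symmetric] w
    by (simp add: inner_add_left inner_add_right ring_distribs)
qed

text \<open>A continuous objective on a nonempty compact set attains its minimum, so the choice
  behind \<open>arg_min_on\<close> really picks a minimizer.\<close>

lemma prox_step_arg_min:
  fixes H :: "real^'n^'n"
  assumes "X \<noteq> {}" "compact X"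
  shows "prox_step X \<gamma> H y v \<in> X"
    and "z \<in> X \<Longrightarrow> prox_objective \<gamma> H y v (prox_step X \<gamma> H y v) \<le> prox_objective \<gamma> H y v z"
proof -
  have "continuous_on X (prox_objective \<gamma> H y v)"
    unfolding prox_objective_def by (intro continuous_intros)
  then obtain a where "a \<in> X" "\<forall>z\<in>X. prox_objective \<gamma> H y v a \<le> prox_objective \<gamma> H y v z"
    using continuous_attains_inf[OF assms(2,1)] by blast
  then have "is_arg_min (prox_objective \<gamma> H y v) (\<lambda>x. x \<in> X) a"
    by (auto simp: is_arg_min_linorder)
  then have "is_arg_min (prox_objective \<gamma> H y v) (\<lambda>x. x \<in> X) (prox_step X \<gamma> H y v)"
    unfolding prox_step_def arg_min_on_def arg_min_def by (rule someI)
  then show "prox_step X \<gamma> H y v \<in> X"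
    and "z \<in> X \<Longrightarrow> prox_objective \<gamma> H y v (prox_step X \<gamma> H y v) \<le> prox_objective \<gamma> H y v z"
    by (auto simp: is_arg_min_linorder)
qed

text \<open>Divide by \<open>s\<close> and let \<open>s\<close> tend to 0 from the right. This turns
  minimality along a segment into a first-order condition.\<close>

lemma nonneg_of_linear_plus_quadratic:
  fixes a b :: real
  assumes "\<And>s. 0 < s \<Longrightarrow> s \<le> 1 \<Longrightarrow> 0 \<le> s * a + s\<^sup>2 * b"
  shows "0 \<le> a"
proof (rule tendsto_lowerbound)
  show "((\<lambda>s. a + s * b) \<longlongrightarrow> a) (at_right 0)"
    by (auto intro!: tendsto_eq_intros)
  have "0 \<le> a + s * b" if "0 < s" "s < 1" for s
  proof -
    have "s * a + s\<^sup>2 * b = s * (a + s * b)" by (simp add: power2_eq_square algebra_simps)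
    then show ?thesis using assms[of s] that by (simp add: zero_le_mult_iff)
  qed
  then show "\<forall>\<^sub>F s in at_right 0. 0 \<le> a + s * b"
    unfolding eventually_at_right_field by (intro exI[of _ 1]) auto
qed simp

text \<open>First-order optimality: compare the minimizer with the points
  \<open>a + s *\<^sub>R (z - a)\<close> of the segment towards \<open>z\<close>, which lie in
  \<open>X\<close> by convexity, and keep the term linear in \<open>s\<close>.\<close>

lemma prox_step_variational:
  fixes H :: "real^'n^'n"
  assumes X: "X \<noteq> {}" "compact X" "convex X" "z \<in> X" and H: "transpose H = H"
  shows "0 \<le> (v + (1 / \<gamma>) *\<^sub>R (H *v (prox_step X \<gamma> H y v - y))) \<bullet> (z - prox_step X \<gamma> H y v)"
proof (rule nonneg_of_linear_plus_quadratic)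
  define a where "a = prox_step X \<gamma> H y v"
  fix s :: real assume s: "0 < s" "s \<le> 1"
  have a: "a \<in> X" using prox_step_arg_min(1)[OF X(1,2)] by (simp add: a_def)
  have "a + s *\<^sub>R (z - a) = (1 - s) *\<^sub>R a + s *\<^sub>R z" by (simp add: algebra_simps)
  then have "a + s *\<^sub>R (z - a) \<in> X" using X(3,4) a s by (simp add: convexD)
  from prox_step_arg_min(2)[OF X(1,2) this, of \<gamma> H y v, folded a_def]
  show "0 \<le> s * ((v + (1 / \<gamma>) *\<^sub>R (H *v (prox_step X \<gamma> H y v - y))) \<bullet> (z - prox_step X \<gamma> H y v))
    + s\<^sup>2 * (1 / (2 * \<gamma>) * ((z - a) \<bullet> (H *v (z - a))))"
    by (simp add: prox_objective_expand[OF H] a_def[symmetric] matrix_vector_mult_scaleR power2_eq_square)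
qed

text \<open>The variational inequality tested at the centre \<open>y\<close> itself; the lower bound
  on \<open>H\<close> then makes the quadratic term coercive.\<close>

lemma prox_step_descent:
  fixes H :: "real^'n^'n"
  assumes X: "X \<noteq> {}" "compact X" "convex X" "y \<in> X" and H: "transpose H = H" "\<rho> *\<^sub>R mat 1 \<preceq>\<^sub>L H"
    and \<gamma>: "0 < \<gamma>"
  shows "v \<bullet> (prox_step X \<gamma> H y v - y) \<le> - (\<rho> / \<gamma>) * (norm (prox_step X \<gamma> H y v - y))\<^sup>2"
proof -
  let ?u = "prox_step X \<gamma> H y v - y"
  have "0 \<le> (v + (1 / \<gamma>) *\<^sub>R (H *v ?u)) \<bullet> (- ?u)"
    using prox_step_variational[OF X H(1), of v \<gamma> y] by simp
  moreover have "(1 / \<gamma>) * (\<rho> * (norm ?u)\<^sup>2) \<le> (1 / \<gamma>) * (?u \<bullet> (H *v ?u))"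
    using loewner_ge_quadratic[OF H(2)] \<gamma> by (intro mult_left_mono) auto
  ultimately show ?thesis
    by (simp add: inner_add_left inner_commute[of "H *v ?u"] del: inner_minus_right minus_diff_eq) (simp add: inner_diff_right algebra_simps)
qed

text \<open>Strong monotonicity: add the variational inequalities of the two steps, each tested at the
  other minimizer. The right-hand side vanishes as the parameters of the first step tend to those of
  the second, whence continuity.\<close>

lemma prox_step_perturbation:
  fixes H H' :: "real^'n^'n"
  assumes X: "X \<noteq> {}" "compact X" "convex X"
    and H: "transpose H = H" "\<rho> *\<^sub>R mat 1 \<preceq>\<^sub>L H" and H': "transpose H' = H'"
    and \<gamma>: "0 < \<gamma>" and \<rho>: "0 < \<rho>"
  shows "norm (prox_step X \<gamma> H y v - prox_step X \<gamma> H' y' v') \<le> \<gamma> / \<rho> * norm (v' - v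
     + (1 / \<gamma>) *\<^sub>R (H' *v (prox_step X \<gamma> H' y' v' - y') - H *v (prox_step X \<gamma> H' y' v' - y)))"
proof -
  define a b where "a = prox_step X \<gamma> H y v" and "b = prox_step X \<gamma> H' y' v'"
  define w where "w = v' - v + (1 / \<gamma>) *\<^sub>R (H' *v (b - y') - H *v (b - y))"
  have aX: "a \<in> X" "b \<in> X" using prox_step_arg_min(1)[OF X(1,2)] by (simp_all add: a_def b_def)
  have "0 \<le> (v + (1 / \<gamma>) *\<^sub>R (H *v (a - y))) \<bullet> (b - a)"
    unfolding a_def by (rule prox_step_variational[OF X _ H(1)]) (rule aX)
  moreover have "0 \<le> (v' + (1 / \<gamma>) *\<^sub>R (H' *v (b - y'))) \<bullet> (a - b)"
    unfolding b_def by (rule prox_step_variational[OF X _ H']) (rule aX)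
  ultimately have "0 \<le> (v' + (1 / \<gamma>) *\<^sub>R (H' *v (b - y')) - (v + (1 / \<gamma>) *\<^sub>R (H *v (a - y)))) \<bullet> (a - b)"
    by (simp add: inner_diff_left inner_diff_right)
  \<comment> \<open>Both fields are evaluated at \<open>b\<close> inside \<open>w\<close>; what
    remains is \<open>H\<close> applied to \<open>a - b\<close>, whose quadratic form is bounded
    below by \<rho>.\<close>
  also have "v' + (1 / \<gamma>) *\<^sub>R (H' *v (b - y')) - (v + (1 / \<gamma>) *\<^sub>R (H *v (a - y)))
      = w - (1 / \<gamma>) *\<^sub>R (H *v (a - b))"
    by (simp add: w_def matrix_vector_mult_diff_distrib algebra_simps)
  finally have "(1 / \<gamma>) * ((a - b) \<bullet> (H *v (a - b))) \<le> w \<bullet> (a - b)"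
    by (simp add: inner_diff_left[of w] inner_commute[of "H *v (a - b)"])
  moreover have "(1 / \<gamma>) * (\<rho> * (norm (a - b))\<^sup>2) \<le> (1 / \<gamma>) * ((a - b) \<bullet> (H *v (a - b)))"
    using loewner_ge_quadratic[OF H(2)] \<gamma> by (intro mult_left_mono) auto
  moreover have "w \<bullet> (a - b) \<le> norm w * norm (a - b)" by (rule norm_cauchy_schwarz)
  ultimately have "(\<rho> / \<gamma> * norm (a - b)) * norm (a - b) \<le> norm w * norm (a - b)"
    by (simp add: power2_eq_square)
  then have "\<rho> / \<gamma> * norm (a - b) \<le> norm w"
    unfolding mult_le_cancel_right by (cases "a = b") auto
  then show ?thesis
    using \<gamma> \<rho> unfolding a_def[symmetric] b_def[symmetric] w_def[symmetric] by (simp add: field_simps)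
qed

lemma continuous_on_prox_step:
  fixes X :: "(real^'n) set"
  assumes X: "X \<noteq> {}" "compact X" "convex X" and \<gamma>: "0 < \<gamma>" and \<rho>: "0 < \<rho>"
  shows "continuous_on {(H :: real^'n^'n, y, v). transpose H = H \<and> \<rho> *\<^sub>R mat 1 \<preceq>\<^sub>L H}
    (\<lambda>(H, y, v). prox_step X \<gamma> H y v)"
    (is "continuous_on ?S ?p")
  unfolding continuous_on_def
proof
  fix q assume "q \<in> ?S"
  then obtain H0 y0 v0 where q: "q = (H0, y0, v0)" and H0: "transpose H0 = H0" "\<rho> *\<^sub>R mat 1 \<preceq>\<^sub>L H0"
    by auto
  define b where "b = prox_step X \<gamma> H0 y0 v0"
  \<comment> \<open>The limit point supplies the primed arguments of the perturbation bound, so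
    \<open>b\<close> is a constant and \<open>r\<close> is an explicit continuous function that
    vanishes at \<open>q\<close>.\<close>
  define r where "r = (\<lambda>(H :: real^'n^'n, y, v). \<gamma> / \<rho> * norm (v0 - v
     + (1 / \<gamma>) *\<^sub>R (H0 *v (b - y0) - H *v (b - y))))"
  have "continuous_on ?S r"
    unfolding r_def case_prod_beta by (intro continuous_intros)
  then have "(r \<longlongrightarrow> r q) (at q within ?S)"
    using \<open>q \<in> ?S\<close> unfolding continuous_on_def by blast
  then have "(r \<longlongrightarrow> 0) (at q within ?S)" by (simp add: r_def q)
  moreover have "\<forall>\<^sub>F p in at q within ?S. norm (?p p - ?p q) \<le> r p"
    unfolding eventually_at_filter
    using prox_step_perturbation[OF X _ _ H0(1) \<gamma> \<rho>]
    by (intro always_eventually) (simp add: r_def q b_def split: prod.split)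
  ultimately have "((\<lambda>p. ?p p - ?p q) \<longlongrightarrow> 0) (at q within ?S)"
    by (rule Lim_null_comparison[rotated])
  then show "(?p \<longlongrightarrow> ?p q) (at q within ?S)" by (simp add: LIM_zero_iff)
qed

text \<open>The minimizer depends continuously on its parameters over the admissible matrices, so
  measurability follows by composition, with values restricted to that set.\<close>

lemma borel_measurable_prox_step:
  fixes H :: "'w \<Rightarrow> real^'n^'n"
  assumes X: "X \<noteq> {}" "compact X" "convex X" and \<gamma>: "0 < \<gamma>" and \<rho>: "0 < \<rho>"
    and [measurable]: "H \<in> borel_measurable M" "y \<in> borel_measurable M" "v \<in> borel_measurable M"
    and H: "\<And>\<omega>. \<omega> \<in> space M \<Longrightarrow> transpose (H \<omega>) = H \<omega> \<and> \<rho> *\<^sub>R mat 1 \<preceq>\<^sub>L H \<omega>"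
  shows "(\<lambda>\<omega>. prox_step X \<gamma> (H \<omega>) (y \<omega>) (v \<omega>)) \<in> borel_measurable M"
proof -
  let ?S = "{(H :: real^'n^'n, y :: real^'n, v :: real^'n). transpose H = H \<and> \<rho> *\<^sub>R mat 1 \<preceq>\<^sub>L H}"
  have "(\<lambda>\<omega>. (H \<omega>, y \<omega>, v \<omega>)) \<in> M \<rightarrow>\<^sub>M restrict_space borel ?S"
    by (rule measurable_restrict_space2) (auto simp: H)
  moreover have "(\<lambda>(H, y, v). prox_step X \<gamma> H y v) \<in> borel_measurable (restrict_space borel ?S)"
    by (rule borel_measurable_continuous_on_restrict[OF continuous_on_prox_step[OF X \<gamma> \<rho>]])
  ultimately have "(\<lambda>\<omega>. (\<lambda>(H, y, v). prox_step X \<gamma> H y v) (H \<omega>, y \<omega>, v \<omega>)) \<in> borel_measurable M"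
    by (rule measurable_compose)
  then show ?thesis by simp
qed

section \<open>Joint measurability\<close>

lemma borel_measurable_continuous_on_range:
  assumes "continuous_on X g" "x \<in> borel_measurable M" "\<And>\<omega>. \<omega> \<in> space M \<Longrightarrow> x \<omega> \<in> X"
  shows "(\<lambda>\<omega>. g (x \<omega>)) \<in> borel_measurable M"
proof (rule measurable_compose[where f = x and g = g])
  show "x \<in> M \<rightarrow>\<^sub>M restrict_space borel X"
    using assms by (auto intro: measurable_restrict_space2)
  show "g \<in> borel_measurable (restrict_space borel X)"
    by (rule borel_measurable_continuous_on_restrict) (rule assms)
qed

text \<open>A Caratheodory function is the limit of its compositions with simple functions converging to
  the identity.\<close>

lemma borel_measurable_pair_Caratheodory:
  fixes F :: "'a::{second_countable_topology, metric_space} \<Rightarrow> 's \<Rightarrow> 'b::metric_space"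
  assumes U: "open U"
    and meas: "\<And>y. y \<in> U \<Longrightarrow> F y \<in> borel_measurable N"
    and cont: "\<And>s. s \<in> space N \<Longrightarrow> continuous_on U (\<lambda>y. F y s)"
  shows "(\<lambda>(y, s). if y \<in> U then F y s else c) \<in> borel_measurable (borel \<Otimes>\<^sub>M N)"
proof -
  obtain q :: "nat \<Rightarrow> 'a \<Rightarrow> 'a" where q: "\<And>i. simple_function borel (q i)" "\<And>y. (\<lambda>i. q i y) \<longlonglongrightarrow> y"
    using borel_measurable_implies_sequence_metric[of "\<lambda>x::'a. x" borel undefined] by auto
  \<comment> \<open>The approximants \<open>q i y\<close> may leave \<open>U\<close> for small
    \<open>i\<close>, hence the extension by \<open>c\<close>; since \<open>U\<close> is open they
    eventually stay in \<open>U\<close>.\<close>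
  define G where "G = (\<lambda>y s. if y \<in> U then F y s else c)"
  have [measurable]: "G y \<in> borel_measurable N" for y
    using meas by (cases "y \<in> U") (auto simp: G_def)
  have [measurable]: "U \<in> sets borel" using U by simp
  have "(\<lambda>p. if fst p \<in> U then G (q i (fst p)) (snd p) else c) \<in> borel_measurable (borel \<Otimes>\<^sub>M N)" for i
  proof -
    \<comment> \<open>A simple function has finite range, so the composition is assembled from
      finitely many sections of \<open>G\<close>, each measurable in the sample.\<close>
    have fin: "finite (range (q i))" using simple_functionD(1)[OF q(1)[of i]] by simp
    have "q i -` {a} \<in> sets borel" for a
      using simple_functionD(2)[OF q(1)[of i], of "{a}"] by simp
    then have "q i \<in> borel \<rightarrow>\<^sub>M count_space (range (q i))"
      using fin by (auto simp: measurable_count_space_eq2)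
    then have "(\<lambda>p. q i (fst p)) \<in> borel \<Otimes>\<^sub>M N \<rightarrow>\<^sub>M count_space (range (q i))"
      by (rule measurable_compose[OF measurable_fst])
    then have [measurable]: "(\<lambda>p. G (q i (fst p)) (snd p)) \<in> borel_measurable (borel \<Otimes>\<^sub>M N)"
      by (rule measurable_compose_countable'[rotated]) (auto intro: countable_finite fin)
    show ?thesis by measurable
  qed
  then have "(\<lambda>p. if fst p \<in> U then F (fst p) (snd p) else c) \<in> borel_measurable (borel \<Otimes>\<^sub>M N)"
  proof (rule borel_measurable_LIMSEQ_metric)
    fix p :: "'a \<times> 's" assume "p \<in> space (borel \<Otimes>\<^sub>M N)"
    then have s: "snd p \<in> space N" by (auto simp: space_pair_measure)
    show "(\<lambda>i. if fst p \<in> U then G (q i (fst p)) (snd p) else c)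
      \<longlonglongrightarrow> (if fst p \<in> U then F (fst p) (snd p) else c)"
    proof (cases "fst p \<in> U")
      case True
      then have ev: "\<forall>\<^sub>F i in sequentially. q i (fst p) \<in> U"
        using q(2) U by (auto dest: topological_tendstoD)
      then have "(\<lambda>i. F (q i (fst p)) (snd p)) \<longlonglongrightarrow> F (fst p) (snd p)"
        using True by (intro continuous_on_tendsto_compose[OF cont[OF s] q(2)])
      moreover have "\<forall>\<^sub>F i in sequentially. F (q i (fst p)) (snd p) = G (q i (fst p)) (snd p)"
        using ev by eventually_elim (simp add: G_def)
      ultimately show ?thesis using True by (simp add: Lim_transform_eventually)
    qed simp
  qed
  then show ?thesis by (simp add: case_prod_beta)
qed

text \<open>Differentiability makes the loss a Caratheodory function, hence jointly measurable. Each
  component of the gradient is then a limit of jointly measurable difference quotients.\<close>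

lemma borel_measurable_pair_gradient:
  fixes F :: "'a::euclidean_space \<Rightarrow> 's \<Rightarrow> real"
  assumes U: "open U" "X \<subseteq> U" and X [measurable]: "X \<in> sets borel"
    and meas: "\<And>y. y \<in> U \<Longrightarrow> F y \<in> borel_measurable N"
    and diff: "\<And>s. s \<in> space N \<Longrightarrow> (\<lambda>y. F y s) differentiable_on U"
  shows "(\<lambda>(y, s). if y \<in> X then gradient (\<lambda>z. F z s) y else 0) \<in> borel_measurable (borel \<Otimes>\<^sub>M N)"
proof -
  define G where "G = (\<lambda>(y, s). if y \<in> U then F y s else 0)"
  have [measurable]: "G \<in> borel_measurable (borel \<Otimes>\<^sub>M N)"
    unfolding G_def
    by (rule borel_measurable_pair_Caratheodory[OF U(1) meas])
       (auto intro: differentiable_imp_continuous_on diff)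
  have "(\<lambda>p. (if fst p \<in> X then gradient (\<lambda>z. F z (snd p)) (fst p) else 0) \<bullet> b)
      \<in> borel_measurable (borel \<Otimes>\<^sub>M N)" for b
  proof (rule borel_measurable_LIMSEQ_metric)
    \<comment> \<open>As \<open>G\<close> is 0 outside \<open>U\<close>, the quotient is measurable
      for every \<open>i\<close>; for large \<open>i\<close> the shifted point lies in
      \<open>U\<close> and \<open>G\<close> agrees with \<open>F\<close> there.\<close>
    fix i
    show "(\<lambda>p. if fst p \<in> X then real (Suc i) *
        (G (fst p + (1 / real (Suc i)) *\<^sub>R b, snd p) - G (fst p, snd p)) else 0) \<in> borel_measurable (borel \<Otimes>\<^sub>M N)"
      by measurable
  next
    fix p :: "'a \<times> 's" assume "p \<in> space (borel \<Otimes>\<^sub>M N)"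
    then have s: "snd p \<in> space N" by (auto simp: space_pair_measure)
    show "(\<lambda>i. if fst p \<in> X then real (Suc i) *
        (G (fst p + (1 / real (Suc i)) *\<^sub>R b, snd p) - G (fst p, snd p)) else 0)
      \<longlonglongrightarrow> (if fst p \<in> X then gradient (\<lambda>z. F z (snd p)) (fst p) else 0) \<bullet> b"
    proof (cases "fst p \<in> X")
      case True
      have "(\<lambda>i. fst p + (1 / real (Suc i)) *\<^sub>R b) \<longlonglongrightarrow> fst p + 0 *\<^sub>R b"
        using LIMSEQ_inverse_real_of_nat by (intro tendsto_intros) (simp add: inverse_eq_divide)
      then have "\<forall>\<^sub>F i in sequentially. fst p + (1 / real (Suc i)) *\<^sub>R b \<in> U"
        using U True by (auto dest!: topological_tendstoD)
      then have "\<forall>\<^sub>F i in sequentially. real (Suc i) * (F (fst p + (1 / real (Suc i)) *\<^sub>R b) (snd p) - F (fst p) (snd p))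
        = real (Suc i) * (G (fst p + (1 / real (Suc i)) *\<^sub>R b, snd p) - G (fst p, snd p))"
        by eventually_elim (use True U in \<open>auto simp: G_def case_prod_beta\<close>)
      moreover have "(\<lambda>i. real (Suc i) * (F (fst p + (1 / real (Suc i)) *\<^sub>R b) (snd p) - F (fst p) (snd p)))
          \<longlonglongrightarrow> gradient (\<lambda>z. F z (snd p)) (fst p) \<bullet> b"
        using True U by (intro directional_difference_quotient[OF diff[OF s]]) auto
      ultimately show ?thesis using True by (simp add: Lim_transform_eventually)
    qed simp
  qed
  then show ?thesis
    by (subst borel_measurable_euclidean_space) (auto simp: case_prod_beta)
qed

section \<open>The sampling noise\<close>

text \<open>Preimages under \<open>W\<close> and \<open>Z\<close> are preimages of measurable sets
  under \<open>X\<close> and \<open>Y\<close>, so independence factorizes the rectangles, and these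
  determine the product measure. Working with generated sigma-algebras lets adapted processes enter
  without being written as functions of the samples.\<close>

lemma (in prob_space) joint_distr_vimage_algebra:
  assumes ind: "indep_var S X T Y"
    and W: "W \<in> vimage_algebra (space M) X S \<rightarrow>\<^sub>M N" and Z: "Z \<in> vimage_algebra (space M) Y T \<rightarrow>\<^sub>M K"
  shows "distr M (N \<Otimes>\<^sub>M K) (\<lambda>\<omega>. (W \<omega>, Z \<omega>)) = distr M N W \<Otimes>\<^sub>M distr M K Z"
proof -
  have rv: "X \<in> M \<rightarrow>\<^sub>M S" "Y \<in> M \<rightarrow>\<^sub>M T"
    using ind by (auto simp: indep_var_eq)
  have id: "(\<lambda>\<omega>. \<omega>) \<in> M \<rightarrow>\<^sub>M vimage_algebra (space M) V R" if "V \<in> M \<rightarrow>\<^sub>M R" for V and R :: "'b measure"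
    using that by (intro measurable_vimage_algebra2) auto
  have [measurable]: "W \<in> M \<rightarrow>\<^sub>M N" "Z \<in> M \<rightarrow>\<^sub>M K"
    using measurable_compose[OF id[OF rv(1)] W] measurable_compose[OF id[OF rv(2)] Z] by simp_all
  interpret W: prob_space "distr M N W" by (rule prob_space_distr) simp
  interpret Z: prob_space "distr M K Z" by (rule prob_space_distr) simp
  have "distr M N W \<Otimes>\<^sub>M distr M K Z = distr M (N \<Otimes>\<^sub>M K) (\<lambda>\<omega>. (W \<omega>, Z \<omega>))"
  proof (rule pair_measure_eqI)
    fix A B assume "A \<in> sets (distr M N W)" "B \<in> sets (distr M K Z)"
    then have A: "A \<in> sets N" and B: "B \<in> sets K" by simp_all
    obtain A' where A': "A' \<in> sets S" "W -` A \<inter> space M = X -` A' \<inter> space M"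
      using measurable_sets[OF W A] measurable_space[OF rv(1)] by (auto simp: sets_vimage_algebra2)
    obtain B' where B': "B' \<in> sets T" "Z -` B \<inter> space M = Y -` B' \<inter> space M"
      using measurable_sets[OF Z B] measurable_space[OF rv(2)] by (auto simp: sets_vimage_algebra2)
    have "(\<lambda>\<omega>. (W \<omega>, Z \<omega>)) -` (A \<times> B) \<inter> space M = (W -` A \<inter> space M) \<inter> (Z -` B \<inter> space M)" by auto
    also have "\<dots> = (\<lambda>\<omega>. (X \<omega>, Y \<omega>)) -` (A' \<times> B') \<inter> space M" unfolding A'(2) B'(2) by auto
    finally have "emeasure (distr M (N \<Otimes>\<^sub>M K) (\<lambda>\<omega>. (W \<omega>, Z \<omega>))) (A \<times> B)
        = emeasure M ((\<lambda>\<omega>. (X \<omega>, Y \<omega>)) -` (A' \<times> B') \<inter> space M)"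
      using A B by (simp add: emeasure_distr)
    also have "\<dots> = emeasure M (X -` A' \<inter> space M) * emeasure M (Y -` B' \<inter> space M)"
      using indep_varD[OF ind A'(1) B'(1)] by (simp add: emeasure_eq_measure ennreal_mult'')
    also have "\<dots> = emeasure (distr M N W) A * emeasure (distr M K Z) B"
      using A B by (simp add: emeasure_distr A'(2) B'(2))
    finally show "emeasure (distr M N W) A * emeasure (distr M K Z) B
      = emeasure (distr M (N \<Otimes>\<^sub>M K) (\<lambda>\<omega>. (W \<omega>, Z \<omega>))) (A \<times> B)" by simp
  qed (simp_all add: W.sigma_finite_measure_axioms Z.sigma_finite_measure_axioms cong: sets_pair_measure_cong)
  then show ?thesis by simp
qed

text \<open>Expand the square. The joint law is a product, so Fubini allows integrating over the
  fresh sample first with \<open>x\<close> and \<open>v\<close> frozen; since \<open>G\<close> is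
  centred, the cross term vanishes.\<close>

lemma (in prob_space) noise_second_moment:
  fixes G :: "'b::euclidean_space \<Rightarrow> 's \<Rightarrow> 'c::euclidean_space" and v :: "'a \<Rightarrow> 'c"
  assumes [measurable]: "x \<in> borel_measurable M" "v \<in> borel_measurable M" and Z [measurable]: "Z \<in> M \<rightarrow>\<^sub>M D"
    and ind: "distr M ((borel \<Otimes>\<^sub>M borel) \<Otimes>\<^sub>M D) (\<lambda>\<omega>. ((x \<omega>, v \<omega>), Z \<omega>))
      = distr M (borel \<Otimes>\<^sub>M borel) (\<lambda>\<omega>. (x \<omega>, v \<omega>)) \<Otimes>\<^sub>M distr M D Z"
    and distr: "distr M D Z = D"
    and G: "(\<lambda>(y, s). G y s) \<in> borel_measurable (borel \<Otimes>\<^sub>M D)"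
    and mean: "\<And>y. integrable D (G y)" "\<And>y. (LINT s|D. G y s) = 0"
    and var: "\<And>y. integrable D (\<lambda>s. (norm (G y s))\<^sup>2)" "\<And>y. (LINT s|D. (norm (G y s))\<^sup>2) \<le> \<sigma>\<^sup>2"
    and v: "integrable M (\<lambda>\<omega>. (norm (v \<omega>))\<^sup>2)"
  shows "integrable M (\<lambda>\<omega>. (norm (a *\<^sub>R G (x \<omega>) (Z \<omega>) + b *\<^sub>R v \<omega>))\<^sup>2)" (is ?int)
    and "expectation (\<lambda>\<omega>. (norm (a *\<^sub>R G (x \<omega>) (Z \<omega>) + b *\<^sub>R v \<omega>))\<^sup>2)
      \<le> a\<^sup>2 * \<sigma>\<^sup>2 + b\<^sup>2 * expectation (\<lambda>\<omega>. (norm (v \<omega>))\<^sup>2)" (is ?le)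
proof -
  let ?W = "\<lambda>\<omega>. (x \<omega>, v \<omega>)" and ?B = "(borel :: 'b measure) \<Otimes>\<^sub>M (borel :: 'c measure)"
  define Q where "Q = distr M ?B ?W"
  define J where "J = (\<lambda>\<omega>. (?W \<omega>, Z \<omega>))"
  have W: "?W \<in> M \<rightarrow>\<^sub>M ?B" by measurable
  have J: "J \<in> M \<rightarrow>\<^sub>M ?B \<Otimes>\<^sub>M D" unfolding J_def by measurable
  have "distr M (?B \<Otimes>\<^sub>M D) J = Q \<Otimes>\<^sub>M D"
    using ind distr by (simp add: Q_def J_def)
  note JQ = this[symmetric]
  interpret D: prob_space D using prob_space_distr[OF Z] distr by simp
  interpret Q: prob_space Q unfolding Q_def by (rule prob_space_distr[OF W])
  interpret QD: pair_sigma_finite Q D ..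
  have [measurable_cong]: "sets Q = sets ?B" by (simp add: Q_def)
  have G' [measurable]: "(\<lambda>p. G (fst (fst p)) (snd p)) \<in> borel_measurable (?B \<Otimes>\<^sub>M D)"
    using measurable_compose[OF _ G, of "\<lambda>p. (fst (fst p), snd p)" "?B \<Otimes>\<^sub>M D"] by simp
  have [measurable]: "(\<lambda>\<omega>. G (x \<omega>) (Z \<omega>)) \<in> borel_measurable M"
    using measurable_compose[OF J G'] by (simp add: J_def)
  \<comment> \<open>Tonelli for nonnegative integrals gives the variance bound before integrability
    of the composed noise is known, and thereby proves it.\<close>
  have "(\<integral>\<^sup>+\<omega>. ennreal ((norm (G (x \<omega>) (Z \<omega>)))\<^sup>2) \<partial>M)
      = (\<integral>\<^sup>+p. ennreal ((norm (G (fst (fst p)) (snd p)))\<^sup>2) \<partial>(Q \<Otimes>\<^sub>M D))"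
    unfolding JQ by (subst nn_integral_distr[OF J]) (simp_all add: J_def)
  also have "\<dots> = (\<integral>\<^sup>+w. \<integral>\<^sup>+s. ennreal ((norm (G (fst w) s))\<^sup>2) \<partial>D \<partial>Q)"
    by (subst D.nn_integral_fst[symmetric]) simp_all
  also have "\<dots> \<le> (\<integral>\<^sup>+w. ennreal (\<sigma>\<^sup>2) \<partial>Q)"
    by (intro nn_integral_mono) (simp add: nn_integral_eq_integral var)
  also have "\<dots> = ennreal (\<sigma>\<^sup>2)" by (simp add: Q.emeasure_space_1)
  finally have nn: "(\<integral>\<^sup>+\<omega>. ennreal ((norm (G (x \<omega>) (Z \<omega>)))\<^sup>2) \<partial>M) \<le> ennreal (\<sigma>\<^sup>2)" .
  then have G2: "integrable M (\<lambda>\<omega>. (norm (G (x \<omega>) (Z \<omega>)))\<^sup>2)"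
    by (intro integrableI_bounded) (auto intro: le_less_trans)
  have EG2: "expectation (\<lambda>\<omega>. (norm (G (x \<omega>) (Z \<omega>)))\<^sup>2) \<le> \<sigma>\<^sup>2"
    using nn by (simp add: nn_integral_eq_integral[OF G2])
  \<comment> \<open>Fubini requires an integrable cross term; it is dominated by the sum of the two
    squares.\<close>
  have cross: "integrable M (\<lambda>\<omega>. G (x \<omega>) (Z \<omega>) \<bullet> v \<omega>)"
  proof (rule Bochner_Integration.integrable_bound)
    show "integrable M (\<lambda>\<omega>. (norm (G (x \<omega>) (Z \<omega>)))\<^sup>2 + (norm (v \<omega>))\<^sup>2)" using G2 v by simp
    have "\<bar>u \<bullet> w\<bar> \<le> (norm u)\<^sup>2 + (norm w)\<^sup>2" for u w :: 'c
    proof -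
      have "\<bar>u \<bullet> w\<bar> \<le> norm u * norm w" by (rule Cauchy_Schwarz_ineq2)
      moreover have "2 * norm u * norm w \<le> (norm u)\<^sup>2 + (norm w)\<^sup>2" by (rule sum_squares_bound)
      moreover have "0 \<le> norm u * norm w" by simp
      ultimately show ?thesis by linarith
    qed
    then show "AE \<omega> in M. norm (G (x \<omega>) (Z \<omega>) \<bullet> v \<omega>) \<le> norm ((norm (G (x \<omega>) (Z \<omega>)))\<^sup>2 + (norm (v \<omega>))\<^sup>2)"
      by simp
  qed simp
  have "expectation (\<lambda>\<omega>. G (x \<omega>) (Z \<omega>) \<bullet> v \<omega>)
      = (LINT p|(Q \<Otimes>\<^sub>M D). G (fst (fst p)) (snd p) \<bullet> snd (fst p))"
    unfolding JQ by (subst integral_distr[OF J]) (simp_all add: J_def)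
  also have "\<dots> = (LINT w|Q. LINT s|D. G (fst w) s \<bullet> snd w)"
  proof (subst QD.integral_fst'[symmetric])
    show "integrable (Q \<Otimes>\<^sub>M D) (\<lambda>p. G (fst (fst p)) (snd p) \<bullet> snd (fst p))"
      unfolding JQ using cross by (subst integrable_distr_eq[OF J]) (simp_all add: J_def)
  qed simp
  also have "\<dots> = 0" by (simp add: mean)
  finally have E0: "expectation (\<lambda>\<omega>. G (x \<omega>) (Z \<omega>) \<bullet> v \<omega>) = 0" .
  have eq: "(norm (a *\<^sub>R G (x \<omega>) (Z \<omega>) + b *\<^sub>R v \<omega>))\<^sup>2 = a\<^sup>2 * (norm (G (x \<omega>) (Z \<omega>)))\<^sup>2
      + 2 * a * b * (G (x \<omega>) (Z \<omega>) \<bullet> v \<omega>) + b\<^sup>2 * (norm (v \<omega>))\<^sup>2" for \<omega>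
    unfolding power2_norm_eq_inner
    by (simp add: inner_add_left inner_add_right inner_commute power2_eq_square algebra_simps)
  show ?int unfolding eq using G2 v cross by simp
  have "expectation (\<lambda>\<omega>. (norm (a *\<^sub>R G (x \<omega>) (Z \<omega>) + b *\<^sub>R v \<omega>))\<^sup>2)
      = a\<^sup>2 * expectation (\<lambda>\<omega>. (norm (G (x \<omega>) (Z \<omega>)))\<^sup>2) + b\<^sup>2 * expectation (\<lambda>\<omega>. (norm (v \<omega>))\<^sup>2)"
    unfolding eq using G2 v cross by (simp add: E0)
  then show ?le using EG2 by (simp add: mult_left_mono)
qed

section \<open>The rate\<close>

text \<open>Each term after the first is bounded by a difference of consecutive logarithms, and
  these telescope. The first term is kept apart: telescoping then starts at
  \<open>ln (1 + m)\<close>, which is nonnegative, whereas \<open>ln m\<close> may be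
  negative.\<close>

lemma sum_inverse_le_ln:
  fixes m :: real
  assumes "0 < m" "1 \<le> T"
  shows "(\<Sum>t=1..T. 1 / (m + real t)) \<le> 1 / (1 + m) + ln (m + real T)"
  using assms(2)
proof (induction T rule: dec_induct)
  case base
  show ?case using assms(1) by (simp add: add.commute)
next
  case (step T)
  define y where "y = m + real T"
  have y: "0 < y" using assms(1) by (simp add: y_def add_pos_nonneg)
  have "ln (y / (y + 1)) \<le> y / (y + 1) - 1" using y by (intro ln_le_minus_one) simp
  also have "\<dots> = - (1 / (y + 1))" using y by (simp add: field_simps)
  finally have "1 / (y + 1) \<le> ln (y + 1) - ln y" using y by (simp add: ln_div)
  then show ?case using step by (simp add: y_def algebra_simps)
qed

text \<open>The deterministic core: \<open>e\<close>, \<open>d\<close> and \<open>\<phi>\<close>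
  stand for the mean squared estimator error, the mean squared step and the mean objective, so that
  only two scalar recursions remain to be combined.\<close>

lemma potential_rate:
  fixes e d \<phi> \<mu> :: "nat \<Rightarrow> real" and \<sigma> \<rho> L k m \<gamma> c fstar M :: real
  assumes \<rho>: "0 < \<rho>" and L: "0 < L" and k: "0 < k" and m: "k\<^sup>2 \<le> m" and \<gamma>: "0 < \<gamma>"
    and c: "8 * L * \<gamma> / \<rho> \<le> c" "c \<le> sqrt m / k"
    and \<mu>: "\<And>t. \<mu> t = k / sqrt (m + real t)"
    and descent: "\<And>t. 1 \<le> t \<Longrightarrow> \<phi> (t + 1) \<le> \<phi> t + \<mu> t * (\<gamma> / \<rho> * e t - 11 / 16 * (\<rho> / \<gamma>) * d t)"
    and error: "\<And>t. 1 \<le> t \<Longrightarrow>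
      e (t + 1) \<le> (1 - c * \<mu> t) * e t + L\<^sup>2 * \<mu> t / c * d t + (c * \<mu> t)\<^sup>2 * \<sigma>\<^sup>2"
    and e1: "e 1 \<le> \<sigma>\<^sup>2" and e: "\<And>t. 1 \<le> t \<Longrightarrow> 0 \<le> e t" and d: "\<And>t. 1 \<le> t \<Longrightarrow> 0 \<le> d t"
    and fstar: "\<And>t. 1 \<le> t \<Longrightarrow> fstar \<le> \<phi> t"
    and T: "1 \<le> T"
    and M: "M = (\<phi> 1 - fstar) / (\<rho> * \<gamma> * k) + 2 * \<sigma>\<^sup>2 / (\<rho> * \<gamma> * k * L)
              + 2 * m * \<sigma>\<^sup>2 / (\<rho> * \<gamma> * k * L) * ln (m + real T)"
  shows "(\<Sum>t=1..T. e t / \<rho>\<^sup>2 + d t / \<gamma>\<^sup>2) \<le> 2 * M * sqrt (m + real T)"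
proof -
  have m0: "0 < m" using k m by (meson less_le_trans zero_less_power)
  have c0: "0 < c" using c(1) L \<gamma> \<rho> by (smt (verit) divide_pos_pos mult_pos_pos)
  have \<mu>0: "0 < \<mu> t" for t using k m0 by (simp add: \<mu> add_pos_nonneg)
  define S where "S = (\<lambda>t. e t / \<rho>\<^sup>2 + d t / \<gamma>\<^sup>2)"
  define V where "V = (\<lambda>t. \<phi> t + e t / (4 * L))"
  \<comment> \<open>The upper bound on \<open>c\<close> says that \<open>c * k\<close> is at most
    \<open>sqrt m\<close>.\<close>
  have noise: "(c * \<mu> t)\<^sup>2 \<le> m * (1 / (m + real t))" for t
  proof -
    have "c * k \<le> sqrt m" using c(2) k by (simp add: field_simps)
    then have "(c * k)\<^sup>2 \<le> (sqrt m)\<^sup>2" using c0 k by (intro power_mono) auto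
    then have "(c * k)\<^sup>2 / (m + real t) \<le> m / (m + real t)" using m0 by (intro divide_right_mono) auto
    then show ?thesis using m0 by (simp add: \<mu> power_mult_distrib power_divide)
  qed
  \<comment> \<open>With weight \<open>1 / (4 * L)\<close>, the lower bound on \<open>c\<close>
    makes the error decay at least \<open>2 * p\<close>, which absorbs the \<open>p\<close> from the
    descent. The drift costs at most \<open>q / 32\<close>, leaving
    \<open>- p - 21 / 32 * q\<close>, at most \<open>- (p + q) / 2\<close>.\<close>
  have step: "\<rho> * \<gamma> / 2 * (\<mu> t * S t) \<le> V t - V (t + 1) + \<sigma>\<^sup>2 * m / (4 * L) * (1 / (m + real t))"
    if t: "1 \<le> t" for t
  proof -
    have "e (t + 1) / (4 * L) \<le> ((1 - c * \<mu> t) * e t + L\<^sup>2 * \<mu> t / c * d t + (c * \<mu> t)\<^sup>2 * \<sigma>\<^sup>2) / (4 * L)"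
      using error[OF t] L by (intro divide_right_mono) auto
    also have "\<dots> = e t / (4 * L) - \<mu> t * e t * (c / (4 * L)) + \<mu> t * d t * (L / (4 * c))
        + (c * \<mu> t)\<^sup>2 * \<sigma>\<^sup>2 / (4 * L)"
      using L c0 by (simp add: field_simps power2_eq_square)
    finally have 1: "e (t + 1) / (4 * L) \<le> e t / (4 * L) - \<mu> t * e t * (c / (4 * L))
        + \<mu> t * d t * (L / (4 * c)) + (c * \<mu> t)\<^sup>2 * \<sigma>\<^sup>2 / (4 * L)" .
    have "2 * \<gamma> / \<rho> \<le> c / (4 * L)" using c(1) L by (simp add: field_simps)
    then have 2: "\<mu> t * e t * (2 * \<gamma> / \<rho>) \<le> \<mu> t * e t * (c / (4 * L))"
      using \<mu>0[of t] e[OF t] by (intro mult_left_mono) auto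
    have "L / (4 * c) \<le> \<rho> / (32 * \<gamma>)" using c(1) c0 \<rho> \<gamma> by (simp add: field_simps)
    then have 3: "\<mu> t * d t * (L / (4 * c)) \<le> \<mu> t * d t * (\<rho> / (32 * \<gamma>))"
      using \<mu>0[of t] d[OF t] by (intro mult_left_mono) auto
    have "\<sigma>\<^sup>2 / (4 * L) * (c * \<mu> t)\<^sup>2 \<le> \<sigma>\<^sup>2 / (4 * L) * (m * (1 / (m + real t)))"
      using L noise by (intro mult_left_mono) auto
    then have 4: "(c * \<mu> t)\<^sup>2 * \<sigma>\<^sup>2 / (4 * L) \<le> \<sigma>\<^sup>2 * m / (4 * L) * (1 / (m + real t))"
      by (simp add: mult.commute)
    define p q where "p = \<mu> t * e t * (\<gamma> / \<rho>)" and "q = \<mu> t * d t * (\<rho> / \<gamma>)"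
    have pq: "0 \<le> p" "0 \<le> q" using \<mu>0[of t] e[OF t] d[OF t] \<gamma> \<rho> by (auto simp: p_def q_def)
    have "\<rho> * \<gamma> / 2 * (\<mu> t * S t) = p / 2 + q / 2"
      using \<rho> \<gamma> by (simp add: S_def p_def q_def field_simps power2_eq_square)
    moreover have "\<phi> (t + 1) \<le> \<phi> t + p - 11 / 16 * q"
      using descent[OF t] by (simp add: p_def q_def algebra_simps)
    moreover have "2 * p \<le> \<mu> t * e t * (c / (4 * L))" using 2 by (simp add: p_def)
    moreover have "\<mu> t * d t * (L / (4 * c)) \<le> q / 32" using 3 by (simp add: q_def)
    ultimately show ?thesis using 1 4 pq unfolding V_def by linarith
  qed
  have tele: "(\<Sum>t=1..T. V t - V (t + 1)) = V 1 - V (T + 1)"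
    using T by (induction T rule: dec_induct) auto
  have ln0: "0 \<le> ln (m + real T)" using m0 T by (intro ln_ge_zero) linarith
  have mu_ge: "\<mu> T \<le> \<mu> t" if "t \<le> T" for t
    using that m0 k by (auto simp: \<mu> intro!: divide_left_mono mult_pos_pos add_pos_nonneg)
  have S0: "0 \<le> S t" if "1 \<le> t" for t using e[OF that] d[OF that] by (simp add: S_def)
  \<comment> \<open>The step sizes decrease, so the smallest one, \<open>\<mu> T\<close>, can be
    pulled out of the weighted sum.\<close>
  have "\<rho> * \<gamma> / 2 * (\<mu> T * (\<Sum>t=1..T. S t)) = (\<Sum>t=1..T. \<rho> * \<gamma> / 2 * (\<mu> T * S t))"
    by (simp add: sum_distrib_left)
  also have "\<dots> \<le> (\<Sum>t=1..T. \<rho> * \<gamma> / 2 * (\<mu> t * S t))"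
    using \<rho> \<gamma> by (intro sum_mono mult_left_mono mult_right_mono mu_ge S0) auto
  also have "\<dots> \<le> (\<Sum>t=1..T. V t - V (t + 1) + \<sigma>\<^sup>2 * m / (4 * L) * (1 / (m + real t)))"
    by (intro sum_mono step) auto
  also have "\<dots> = V 1 - V (T + 1) + \<sigma>\<^sup>2 * m / (4 * L) * (\<Sum>t=1..T. 1 / (m + real t))"
    unfolding sum.distrib tele sum_distrib_left ..
  also have "\<dots> \<le> V 1 - V (T + 1) + \<sigma>\<^sup>2 * m / (4 * L) * (1 / (1 + m) + ln (m + real T))"
    using sum_inverse_le_ln[OF m0 T] m0 L by (intro add_left_mono mult_left_mono) auto
  also have "\<dots> = V 1 - V (T + 1) + \<sigma>\<^sup>2 / (4 * L) * (m / (1 + m)) + m * \<sigma>\<^sup>2 / (4 * L) * ln (m + real T)"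
    by (subst distrib_left) (simp add: mult.commute mult.left_commute)
  \<comment> \<open>Two terms \<open>\<sigma>\<^sup>2 / (4 * L)\<close> arise, one from the initial
    error and one from the first harmonic term through \<open>m / (1 + m) \<le> 1\<close>; together
    they fit into \<open>2 * \<sigma>\<^sup>2 / L\<close>.\<close>
  also have "\<dots> \<le> (\<phi> 1 - fstar) + 2 * \<sigma>\<^sup>2 / L + 2 * m * \<sigma>\<^sup>2 / L * ln (m + real T)"
  proof -
    have "V 1 \<le> \<phi> 1 + \<sigma>\<^sup>2 / (4 * L)" using e1 L by (simp add: V_def divide_right_mono)
    moreover have "fstar \<le> V (T + 1)"
      using fstar[of "T + 1"] e[of "T + 1"] L by (simp add: V_def add_increasing2)
    moreover have "\<sigma>\<^sup>2 / (4 * L) * (m / (1 + m)) \<le> \<sigma>\<^sup>2 / (4 * L) * 1"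
      using L m0 by (intro mult_left_mono) auto
    moreover have "m * \<sigma>\<^sup>2 / (4 * L) * ln (m + real T) \<le> 2 * m * \<sigma>\<^sup>2 / L * ln (m + real T)"
      using L m0 ln0 by (intro mult_right_mono) (auto simp: field_simps)
    moreover have "\<sigma>\<^sup>2 / (4 * L) + \<sigma>\<^sup>2 / (4 * L) \<le> 2 * \<sigma>\<^sup>2 / L" using L by (simp add: field_simps)
    ultimately show ?thesis by linarith
  qed
  also have "\<dots> = \<rho> * \<gamma> * k * M"
    unfolding M using \<rho> \<gamma> k L by (simp add: field_simps)
  finally have "\<rho> * \<gamma> / 2 * (\<mu> T * (\<Sum>t=1..T. S t)) \<le> \<rho> * \<gamma> * k * M" .
  \<comment> \<open>Substituting \<open>\<mu> T = k / sqrt (m + real T)\<close> and clearing it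
    produces the factor \<open>2 * sqrt (m + real T)\<close>.\<close>
  then have "\<rho> * \<gamma> * k * (\<Sum>t=1..T. S t) \<le> \<rho> * \<gamma> * k * (2 * M * sqrt (m + real T))"
    using m0 by (simp add: \<mu> field_simps add_pos_nonneg)
  then show ?thesis using \<rho> \<gamma> k by (simp add: S_def)
qed

text \<open>Cauchy-Schwarz bounds the sum by the root of \<open>T\<close> times the sum of squares.
  Applying subadditivity of the square root twice splits the fourth root of \<open>m + T\<close>,
  which gives the two terms of the rate.\<close>

lemma average_le_of_sum_squares:
  fixes a :: "nat \<Rightarrow> real"
  assumes "1 \<le> T" "0 \<le> m" and sq: "(\<Sum>t=1..T. (a t)\<^sup>2) \<le> 4 * M * sqrt (m + real T)"
  shows "1 / real T * (\<Sum>t=1..T. a t)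
    \<le> 2 * sqrt (2 * M) * m powr (1/4) / sqrt (real T) + 2 * sqrt (2 * M) / real T powr (1/4)"
proof -
  have T: "0 < real T" using assms(1) by simp
  \<comment> \<open>Nonnegativity of \<open>M\<close> is forced by \<open>sq\<close>, whose left
    side is a sum of squares.\<close>
  have M0: "0 \<le> M"
  proof -
    have "0 \<le> 4 * M * sqrt (m + real T)" using sq by (meson order_trans sum_nonneg zero_le_power2)
    then show ?thesis using T assms(2) by (simp add: zero_le_mult_iff)
  qed
  have "(\<Sum>t=1..T. a t)\<^sup>2 \<le> (\<Sum>t=1..T. (a t)\<^sup>2) * real (card {1..T})"
    by (rule sum_squared_le_sum_of_squares)
  also have "\<dots> \<le> 4 * M * sqrt (m + real T) * real T"
    using sq by (simp add: mult_right_mono)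
  finally have "(\<Sum>t=1..T. a t) \<le> sqrt (4 * M * sqrt (m + real T) * real T)" by (rule real_le_rsqrt)
  also have "\<dots> = 2 * sqrt M * sqrt (sqrt (m + real T)) * sqrt (real T)"
    by (simp add: real_sqrt_mult)
  also have "sqrt (sqrt (m + real T)) \<le> sqrt (sqrt m) + sqrt (sqrt (real T))"
  proof -
    have "sqrt (m + real T) \<le> sqrt m + sqrt (real T)" using assms(2) by (intro sqrt_add_le_add_sqrt) auto
    then have "sqrt (sqrt (m + real T)) \<le> sqrt (sqrt m + sqrt (real T))" by simp
    also have "\<dots> \<le> sqrt (sqrt m) + sqrt (sqrt (real T))" using assms(2) by (intro sqrt_add_le_add_sqrt) auto
    finally show ?thesis .
  qed
  finally have "(\<Sum>t=1..T. a t) \<le> 2 * sqrt M * (sqrt (sqrt m) + sqrt (sqrt (real T))) * sqrt (real T)"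
    using M0 by (simp add: mult_left_mono mult_right_mono)
  also have "\<dots> \<le> 2 * sqrt (2 * M) * (sqrt (sqrt m) + sqrt (sqrt (real T))) * sqrt (real T)"
    using M0 assms(2) by (intro mult_right_mono mult_left_mono) auto
  finally have "1 / real T * (\<Sum>t=1..T. a t)
      \<le> 1 / real T * (2 * sqrt (2 * M) * (sqrt (sqrt m) + sqrt (sqrt (real T))) * sqrt (real T))"
    using T by (intro mult_left_mono) auto
  also have "\<dots> = 2 * sqrt (2 * M) * sqrt (sqrt m) / sqrt (real T) + 2 * sqrt (2 * M) / sqrt (sqrt (real T))"
  proof -
    \<comment> \<open>In terms of the fourth root \<open>r\<close> of \<open>T\<close> the identity
      becomes rational.\<close>
    define r where "r = sqrt (sqrt (real T))"
    have r: "0 < r" "sqrt (real T) = r\<^sup>2" and "(sqrt (real T))\<^sup>2 = real T"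
      using T by (simp_all add: r_def power4_eq_xxxx)
    then have r4: "real T = r ^ 4" by (simp add: power2_eq_square power4_eq_xxxx)
    show ?thesis using r(1) unfolding r_def[symmetric] r(2) r4
      by (simp add: field_simps power2_eq_square power4_eq_xxxx)
  qed
  finally show ?thesis
    using assms(2) by (simp add: powr_half_sqrt[symmetric] powr_powr)
qed

section \<open>Convergence of the averaged estimator\<close>

text \<open>The weight \<open>a\<close> enters by scaling the two norms with \<open>sqrt a\<close>
  and its inverse before applying the inequality between the product and the squares.\<close>

lemma norm_add_squared_Young:
  fixes u v :: "'a::real_inner"
  assumes "0 < a"
  shows "(norm (u + v))\<^sup>2 \<le> (1 + a) * (norm u)\<^sup>2 + (1 + 1 / a) * (norm v)\<^sup>2"
proof -
  have "u \<bullet> v \<le> norm u * norm v" by (rule norm_cauchy_schwarz)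
  moreover have "2 * (sqrt a * norm u) * (norm v / sqrt a) \<le> (sqrt a * norm u)\<^sup>2 + (norm v / sqrt a)\<^sup>2"
    by (rule sum_squares_bound)
  then have "2 * (norm u * norm v) \<le> a * (norm u)\<^sup>2 + (norm v)\<^sup>2 / a"
    using assms by (simp add: power_mult_distrib power_divide)
  moreover have "(norm (u + v))\<^sup>2 = (norm u)\<^sup>2 + 2 * (u \<bullet> v) + (norm v)\<^sup>2"
    by (simp add: power2_norm_eq_inner inner_add_left inner_add_right inner_commute)
  ultimately show ?thesis by (simp add: distrib_right)
qed

lemma integrable_nonneg_bound:
  fixes f u :: "'a \<Rightarrow> real"
  assumes "integrable M u" "f \<in> borel_measurable M"
    and "\<And>x. x \<in> space M \<Longrightarrow> 0 \<le> f x" "\<And>x. x \<in> space M \<Longrightarrow> f x \<le> u x"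
  shows "integrable M f"
  by (rule Bochner_Integration.integrable_bound[OF assms(1,2)])
     (use assms(3,4) in \<open>auto intro!: AE_I2 intro: order_trans[OF _ abs_ge_self]\<close>)

lemma minus_inner_le_Young:
  fixes u v :: "'a::real_inner"
  assumes "0 < \<gamma>" "0 < \<rho>"
  shows "- (u \<bullet> v) \<le> \<gamma> / \<rho> * (norm u)\<^sup>2 + \<rho> / (4 * \<gamma>) * (norm v)\<^sup>2"
proof -
  \<comment> \<open>Half of \<open>a * (norm u)\<^sup>2 + (norm v)\<^sup>2 / a\<close> is the
    claimed bound for exactly this weight.\<close>
  define a where "a = 2 * \<gamma> / \<rho>"
  have a: "0 < a" using assms by (simp add: a_def)
  have "- (u \<bullet> v) \<le> norm u * norm v" using Cauchy_Schwarz_ineq2[of u v] by linarith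
  moreover have "2 * (sqrt a * norm u) * (norm v / sqrt a) \<le> (sqrt a * norm u)\<^sup>2 + (norm v / sqrt a)\<^sup>2"
    by (rule sum_squares_bound)
  then have "2 * (norm u * norm v) \<le> a * (norm u)\<^sup>2 + (norm v)\<^sup>2 / a"
    using a by (simp add: power_mult_distrib power_divide)
  moreover have "a * (norm u)\<^sup>2 = 2 * (\<gamma> / \<rho> * (norm u)\<^sup>2)" "(norm v)\<^sup>2 / a = 2 * (\<rho> / (4 * \<gamma>) * (norm v)\<^sup>2)"
    by (simp_all add: a_def)
  ultimately show ?thesis by linarith
qed

theorem theorem2:
  fixes X U :: "(real^'n) set"
    and D :: "'s measure" and F :: "real^'n \<Rightarrow> 's \<Rightarrow> real" and f :: "real^'n \<Rightarrow> real"
    and P :: "'w measure" and \<xi> :: "nat \<Rightarrow> 'w \<Rightarrow> 's"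
    and h :: "nat \<Rightarrow> (nat \<Rightarrow> 's) \<Rightarrow> real^'n^'n" and H :: "nat \<Rightarrow> 'w \<Rightarrow> real^'n^'n"
    and x1 :: "real^'n" and x xt g :: "nat \<Rightarrow> 'w \<Rightarrow> real^'n"
    and \<mu> \<alpha> :: "nat \<Rightarrow> real"
    and \<sigma> \<rho> L k m \<gamma> c fstar M :: real and T :: nat
  assumes X: "X \<noteq> {}" "compact X" "convex X"
    and U: "open U" "X \<subseteq> U"
    and D: "prob_space D"
    and F_integrable: "\<And>y. y \<in> U \<Longrightarrow> integrable D (F y)"
    and f_eq: "\<And>y. y \<in> U \<Longrightarrow> f y = (LINT s|D. F y s)"
    and F_diff: "\<And>s. s \<in> space D \<Longrightarrow> (\<lambda>y. F y s) differentiable_on U"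
    and f_diff: "f differentiable_on U"
    and \<sigma>: "0 < \<sigma>"
    and unbiased: "\<And>y. y \<in> X \<Longrightarrow>
      integrable D (\<lambda>s. gradient (\<lambda>z. F z s) y) \<and>
      (LINT s|D. gradient (\<lambda>z. F z s) y) = gradient f y"
    and variance: "\<And>y. y \<in> X \<Longrightarrow>
      integrable D (\<lambda>s. (norm (gradient (\<lambda>z. F z s) y - gradient f y))\<^sup>2) \<and>
      (LINT s|D. (norm (gradient (\<lambda>z. F z s) y - gradient f y))\<^sup>2) \<le> \<sigma>\<^sup>2"
    and f_bdd: "bdd_below (f ` X)"
    and fstar: "fstar = (INF y\<in>X. f y)"
    and \<rho>: "0 < \<rho>"
    and H_ge: "\<And>t \<omega>. 1 \<le> t \<Longrightarrow> \<omega> \<in> space P \<Longrightarrow> \<rho> *\<^sub>R mat 1 \<preceq>\<^sub>L H t \<omega>"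
    and L: "0 < L"
    and smooth: "\<And>y z. y \<in> X \<Longrightarrow> z \<in> X \<Longrightarrow>
      norm (gradient f y - gradient f z) \<le> L * norm (y - z)"
    and P: "prob_space P"
    and samples_indep: "prob_space.indep_vars P (\<lambda>_. D) \<xi> {1..}"
    and samples_distr: "\<And>t. 1 \<le> t \<Longrightarrow> distr P D (\<xi> t) = D"
    and rule_measurable: "\<And>t. 1 \<le> t \<Longrightarrow> h t \<in> borel_measurable (PiM {1..t} (\<lambda>_. D))"
    and H_rule: "\<And>t \<omega>. 1 \<le> t \<Longrightarrow> \<omega> \<in> space P \<Longrightarrow> H t \<omega> = h t (\<lambda>i\<in>{1..t}. \<xi> i \<omega>)"
    and path: "\<And>\<omega>. \<omega> \<in> space P \<Longrightarrow>
      super_adam_path 0 X F \<gamma> \<mu> \<alpha> x1 (\<lambda>t. \<xi> t \<omega>) (\<lambda>t. H t \<omega>)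
        (\<lambda>t. x t \<omega>) (\<lambda>t. xt t \<omega>) (\<lambda>t. g t \<omega>)"
    and k: "0 < k"
    and m: "k\<^sup>2 \<le> m"
    and \<gamma>: "0 < \<gamma>" "\<gamma> \<le> \<rho> * sqrt m / (8 * L * k)"
    and c: "8 * L * \<gamma> / \<rho> \<le> c" "c \<le> sqrt m / k"
    and \<mu>: "\<And>t. \<mu> t = k / sqrt (m + real t)"
    and \<alpha>: "\<And>t. \<alpha> (t + 1) = c * \<mu> t"
    and T: "1 \<le> T"
    and M: "M = (f x1 - fstar) / (\<rho> * \<gamma> * k) + 2 * \<sigma>\<^sup>2 / (\<rho> * \<gamma> * k * L)
              + 2 * m * \<sigma>\<^sup>2 / (\<rho> * \<gamma> * k * L) * ln (m + real T)"
  shows "(\<forall>t\<in>{1..T}.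
      integrable P (\<lambda>\<omega>. norm (gradient_mapping X (H t \<omega>) (x t \<omega>) (gradient f (x t \<omega>)) \<gamma>)) \<and>
      integrable P (\<lambda>\<omega>. convergence_measure \<rho> \<gamma> f (x t \<omega>) (g t \<omega>) (xt (t + 1) \<omega>)))
    \<and> 1 / real T * (\<Sum>t=1..T. prob_space.expectation P
          (\<lambda>\<omega>. norm (gradient_mapping X (H t \<omega>) (x t \<omega>) (gradient f (x t \<omega>)) \<gamma>)))
      \<le> 1 / real T * (\<Sum>t=1..T. prob_space.expectation P
          (\<lambda>\<omega>. convergence_measure \<rho> \<gamma> f (x t \<omega>) (g t \<omega>) (xt (t + 1) \<omega>)))
    \<and> 1 / real T * (\<Sum>t=1..T. prob_space.expectation P
          (\<lambda>\<omega>. convergence_measure \<rho> \<gamma> f (x t \<omega>) (g t \<omega>) (xt (t + 1) \<omega>)))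
      \<le> 2 * sqrt (2 * M) * m powr (1/4) / sqrt (real T)
         + 2 * sqrt (2 * M) / real T powr (1/4)"
proof -
  interpret P: prob_space P by (rule P)
  interpret D: prob_space D by (rule D)
  define E where "E = (\<lambda>t \<omega>. g t \<omega> - gradient f (x t \<omega>))"
  \<comment> \<open>\<open>V t\<close> equals \<open>g t - gradient f (x (t + 1))\<close>: the error
    of the old estimator at the new iterate, before the new sample is drawn.\<close>
  define V where "V = (\<lambda>t \<omega>. E t \<omega> + gradient f (x t \<omega>) - gradient f (x (t + 1) \<omega>))"
  \<comment> \<open>Centred sampling noise; the value 0 outside \<open>X\<close> makes the mean and
    variance conditions hold for every \<open>y\<close>.\<close>
  define G where "G = (\<lambda>y s. if y \<in> X then gradient (\<lambda>z. F z s) y - gradient f y else 0)"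
  define e where "e = (\<lambda>t. P.expectation (\<lambda>\<omega>. (norm (E t \<omega>))\<^sup>2))"
  define d where "d = (\<lambda>t. P.expectation (\<lambda>\<omega>. (norm (xt (t + 1) \<omega> - x t \<omega>))\<^sup>2))"
  define \<phi> where "\<phi> = (\<lambda>t. P.expectation (\<lambda>\<omega>. f (x t \<omega>)))"

  \<comment> \<open>Parameters and iterates along a sample path\<close>
  have m0: "0 < m" using k m by (meson less_le_trans zero_less_power)
  have c0: "0 < c" using c(1) L \<gamma>(1) \<rho> by (smt (verit) divide_pos_pos mult_pos_pos)
  have [measurable]: "X \<in> sets borel" using X(2) by (simp add: borel_closed compact_imp_closed)
  have \<mu>0: "0 < \<mu> t" for t using k m0 by (simp add: \<mu> add_pos_nonneg)
  \<comment> \<open>The parameter ranges are part of the path condition, which is available only at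
    a sample point; any point serves, because the parameters are deterministic.\<close>
  obtain \<omega>0 where "\<omega>0 \<in> space P" using P.not_empty by auto
  have \<mu>1: "\<mu> t \<le> 1" and \<alpha>1: "c * \<mu> t \<le> 1" if "1 \<le> t" for t
    using path[OF \<open>\<omega>0 \<in> space P\<close>] that \<alpha>[of t] by (auto simp: super_adam_path_def)
  have x1: "x 1 \<omega> = x1" "x1 \<in> X" and g1: "g 1 \<omega> = gradient (\<lambda>y. F y (\<xi> 1 \<omega>)) x1"
    if "\<omega> \<in> space P" for \<omega>
    using path[OF that] by (auto simp: super_adam_path_def)
  have x1X: "x1 \<in> X" using x1(2)[OF \<open>\<omega>0 \<in> space P\<close>] .
  have Hsym: "transpose (H t \<omega>) = H t \<omega>"
    and xt: "xt (t + 1) \<omega> = prox_step X \<gamma> (H t \<omega>) (x t \<omega>) (g t \<omega>)"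
    and x_Suc: "x (t + 1) \<omega> = (1 - \<mu> t) *\<^sub>R x t \<omega> + \<mu> t *\<^sub>R xt (t + 1) \<omega>"
    and g_Suc: "g (t + 1) \<omega> = (c * \<mu> t) *\<^sub>R gradient (\<lambda>y. F y (\<xi> (t + 1) \<omega>)) (x (t + 1) \<omega>)
      + (1 - c * \<mu> t) *\<^sub>R g t \<omega>"
    if "1 \<le> t" "\<omega> \<in> space P" for t \<omega>
    using path[OF that(2)] that(1) \<alpha>[of t] by (auto simp: super_adam_path_def)
  have xtX: "xt (t + 1) \<omega> \<in> X" if "1 \<le> t" "\<omega> \<in> space P" for t \<omega>
    unfolding xt[OF that] by (rule prox_step_arg_min(1)[OF X(1,2)])
  have xX: "x t \<omega> \<in> X" if "1 \<le> t" "\<omega> \<in> space P" for t \<omega>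
    using that(1)
  proof (induction t rule: dec_induct)
    case base
    show ?case using x1[OF that(2)] by simp
  next
    case (step t)
    then show ?case
      using x_Suc[OF _ that(2), of t] xtX[OF _ that(2), of t] X(3) \<mu>1[of t] \<mu>0[of t] by (simp add: convexD)
  qed
  have f_cont: "continuous_on X f"
    using f_diff U by (meson continuous_on_subset differentiable_imp_continuous_on)
  have grad_cont: "continuous_on X (gradient f)"
  proof (rule lipschitz_on_continuous_on)
    show "L-lipschitz_on X (gradient f)"
      using smooth L by (auto simp: lipschitz_on_def dist_norm)
  qed

  \<comment> \<open>The filtration generated by the samples\<close>
  define A where "A = (\<lambda>t. vimage_algebra (space P) (\<lambda>\<omega>. restrict (\<lambda>i. \<xi> i \<omega>) {1..t}) (PiM {1..t} (\<lambda>_. D)))"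
  have space_A [simp]: "space (A t) = space P" for t by (simp add: A_def)
  have \<xi>P [measurable]: "\<xi> t \<in> P \<rightarrow>\<^sub>M D" if "1 \<le> t" for t
    using samples_indep that by (auto simp: P.indep_vars_def)
  have restr: "(\<lambda>\<omega>. restrict (\<lambda>i. \<xi> i \<omega>) {1..t}) \<in> P \<rightarrow>\<^sub>M PiM {1..t} (\<lambda>_. D)" for t
    by (rule measurable_restrict) auto
  have restrA: "(\<lambda>\<omega>. restrict (\<lambda>i. \<xi> i \<omega>) {1..t}) \<in> A t \<rightarrow>\<^sub>M PiM {1..t} (\<lambda>_. D)" for t
    unfolding A_def using measurable_space[OF restr] by (intro measurable_vimage_algebra1) auto
  have \<xi>A: "\<xi> i \<in> A t \<rightarrow>\<^sub>M D" if "1 \<le> i" "i \<le> t" for i t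
    using measurable_compose[OF restrA measurable_component_singleton, of i t] that by simp
  have A_P: "w \<in> P \<rightarrow>\<^sub>M N" if "w \<in> A t \<rightarrow>\<^sub>M N" for w t and N :: "'b measure"
  proof -
    have "(\<lambda>\<omega>. \<omega>) \<in> P \<rightarrow>\<^sub>M A t"
      unfolding A_def using restr by (intro measurable_vimage_algebra2) auto
    then show ?thesis using that by (rule measurable_compose)
  qed
  have A_Suc: "w \<in> A (t + 1) \<rightarrow>\<^sub>M N" if "w \<in> A t \<rightarrow>\<^sub>M N" for w t and N :: "'b measure"
  proof -
    have "(\<lambda>\<omega>. restrict (\<lambda>i. \<xi> i \<omega>) {1..t}) \<in> A (t + 1) \<rightarrow>\<^sub>M PiM {1..t} (\<lambda>_. D)"
      by (rule measurable_restrict) (auto intro: \<xi>A)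
    then have "(\<lambda>\<omega>. \<omega>) \<in> A (t + 1) \<rightarrow>\<^sub>M A t"
      unfolding A_def by (intro measurable_vimage_algebra2) auto
    then show ?thesis using that by (rule measurable_compose)
  qed
  have H_A: "H t \<in> borel_measurable (A t)" if "1 \<le> t" for t
    using measurable_compose[OF restrA rule_measurable[OF that]] H_rule[OF that]
    by (subst measurable_cong[where g = "\<lambda>\<omega>. h t (restrict (\<lambda>i. \<xi> i \<omega>) {1..t})"]) auto

  \<comment> \<open>Sampling noise and the error recursion\<close>
  have G_meas: "(\<lambda>(y, s). G y s) \<in> borel_measurable (borel \<Otimes>\<^sub>M D)"
  proof -
    have "(\<lambda>(y, s). if y \<in> X then gradient (\<lambda>z. F z s) y else 0) \<in> borel_measurable (borel \<Otimes>\<^sub>M D)"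
      using F_integrable F_diff by (intro borel_measurable_pair_gradient[OF U]) auto
    moreover have "(\<lambda>y. indicator X y *\<^sub>R gradient f y) \<in> borel_measurable borel"
      by (rule borel_measurable_continuous_on_indicator[OF _ grad_cont]) simp
    ultimately have "(\<lambda>p. (case p of (y, s) \<Rightarrow> if y \<in> X then gradient (\<lambda>z. F z s) y else 0)
        - indicator X (fst p) *\<^sub>R gradient f (fst p)) \<in> borel_measurable (borel \<Otimes>\<^sub>M D)"
      by measurable
    then show ?thesis
      by (rule measurable_cong[THEN iffD1, rotated]) (auto simp: G_def)
  qed
  have G_comp: "(\<lambda>\<omega>. G (y \<omega>) (z \<omega>)) \<in> borel_measurable N"
    if "y \<in> borel_measurable N" "z \<in> N \<rightarrow>\<^sub>M D" for y z and N :: "'w measure"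
    using that by (rule measurable_Pair_compose_split[OF G_meas])
  have G_mean: "integrable D (G y)" "(LINT s|D. G y s) = 0" for y
  proof -
    have "integrable D (G y) \<and> (LINT s|D. G y s) = 0"
    proof (cases "y \<in> X")
      case True
      then show ?thesis using unbiased[OF True] by (simp add: G_def D.prob_space)
    qed (simp add: G_def)
    then show "integrable D (G y)" "(LINT s|D. G y s) = 0" by auto
  qed
  have G_var: "integrable D (\<lambda>s. (norm (G y s))\<^sup>2)" "(LINT s|D. (norm (G y s))\<^sup>2) \<le> \<sigma>\<^sup>2" for y
  proof -
    have "integrable D (\<lambda>s. (norm (G y s))\<^sup>2) \<and> (LINT s|D. (norm (G y s))\<^sup>2) \<le> \<sigma>\<^sup>2"
    proof (cases "y \<in> X")
      case True
      then show ?thesis using variance[OF True] by (simp add: G_def)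
    qed (simp add: G_def)
    then show "integrable D (\<lambda>s. (norm (G y s))\<^sup>2)" "(LINT s|D. (norm (G y s))\<^sup>2) \<le> \<sigma>\<^sup>2" by auto
  qed

  have E_1: "E 1 \<omega> = G x1 (\<xi> 1 \<omega>)" if "\<omega> \<in> space P" for \<omega>
    using x1[OF that] g1[OF that] by (simp add: E_def G_def)
  \<comment> \<open>Subtract the gradient at the new iterate, split with the weights
    \<open>c * \<mu> t\<close> and \<open>1 - c * \<mu> t\<close>.\<close>
  have E_Suc: "E (t + 1) \<omega> = (c * \<mu> t) *\<^sub>R G (x (t + 1) \<omega>) (\<xi> (t + 1) \<omega>) + (1 - c * \<mu> t) *\<^sub>R V t \<omega>"
    if "1 \<le> t" "\<omega> \<in> space P" for t \<omega>
    using xX[of "t + 1" \<omega>] that g_Suc[OF that] by (simp add: E_def V_def G_def algebra_simps)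

  \<comment> \<open>Adaptedness of the iterates\<close>
  have grad_comp: "(\<lambda>\<omega>. gradient f (x t \<omega>)) \<in> borel_measurable N"
    if "x t \<in> borel_measurable N" "space N = space P" "1 \<le> t" for N t
    by (rule borel_measurable_continuous_on_range[OF grad_cont]) (use that xX in auto)
  have prox_meas: "(\<lambda>\<omega>. prox_step X \<gamma> (H t \<omega>) (x t \<omega>) (v \<omega>)) \<in> borel_measurable (A t)"
    if "1 \<le> t" "x t \<in> borel_measurable (A t)" "v \<in> borel_measurable (A t)" for v t
    by (rule borel_measurable_prox_step[OF X \<gamma>(1) \<rho> H_A]) (use that Hsym H_ge in auto)
  \<comment> \<open>The new iterate is already determined by the first \<open>t\<close> samples;
    this one-step lead makes it independent of sample \<open>t + 1\<close>.\<close>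
  have x_Suc_meas: "x (t + 1) \<in> borel_measurable (A t)" "xt (t + 1) \<in> borel_measurable (A t)"
    if "1 \<le> t" "x t \<in> borel_measurable (A t)" "g t \<in> borel_measurable (A t)" for t
  proof -
    show *: "xt (t + 1) \<in> borel_measurable (A t)"
      by (rule measurable_cong[THEN iffD2, OF _ prox_meas[OF that]]) (use xt[OF that(1)] in simp)
    show "x (t + 1) \<in> borel_measurable (A t)"
    proof (rule measurable_cong[THEN iffD2])
      show "(\<lambda>\<omega>. (1 - \<mu> t) *\<^sub>R x t \<omega> + \<mu> t *\<^sub>R xt (t + 1) \<omega>) \<in> borel_measurable (A t)"
        using that(2) * by measurable
    qed (use x_Suc[OF that(1)] in simp)
  qed
  have meas: "x t \<in> borel_measurable (A t) \<and> g t \<in> borel_measurable (A t)" if "1 \<le> t" for t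
    using that
  proof (induction t rule: dec_induct)
    case base
    have "x 1 \<in> borel_measurable (A 1)"
      by (rule measurable_cong[THEN iffD2, of _ _ "\<lambda>_. x1"]) (use x1(1) in auto)
    moreover have "(\<lambda>\<omega>. G x1 (\<xi> 1 \<omega>) + gradient f x1) \<in> borel_measurable (A 1)"
      by (intro borel_measurable_add G_comp \<xi>A) auto
    then have "g 1 \<in> borel_measurable (A 1)"
      by (rule measurable_cong[THEN iffD1, rotated]) (use g1 x1X in \<open>simp add: G_def\<close>)
    ultimately show ?case by simp
  next
    case (step t)
    have x': "x (t + 1) \<in> borel_measurable (A (t + 1))"
      using step x_Suc_meas(1) by (intro A_Suc) auto
    have g': "g t \<in> borel_measurable (A (t + 1))" using step by (intro A_Suc) auto
    \<comment> \<open>On \<open>X\<close> the sampled gradient is \<open>G\<close> plus the true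
      gradient, which brings in the joint measurability of \<open>G\<close>.\<close>
    have "(\<lambda>\<omega>. (c * \<mu> t) *\<^sub>R (G (x (t + 1) \<omega>) (\<xi> (t + 1) \<omega>) + gradient f (x (t + 1) \<omega>))
        + (1 - c * \<mu> t) *\<^sub>R g t \<omega>) \<in> borel_measurable (A (t + 1))"
      by (intro borel_measurable_add borel_measurable_scaleR borel_measurable_const G_comp grad_comp \<xi>A x' g') auto
    then have "g (t + 1) \<in> borel_measurable (A (t + 1))"
      by (rule measurable_cong[THEN iffD1, rotated]) (use step xX[of "t + 1"] g_Suc in \<open>simp add: G_def\<close>)
    then show ?case using x' by simp
  qed
  have xA: "x t \<in> borel_measurable (A t)" and gA: "g t \<in> borel_measurable (A t)"
    and xSA: "x (t + 1) \<in> borel_measurable (A t)" and xtA: "xt (t + 1) \<in> borel_measurable (A t)"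
    if "1 \<le> t" for t
    using meas[OF that] x_Suc_meas[OF that] by auto
  have VA: "V t \<in> borel_measurable (A t)" if "1 \<le> t" for t
    unfolding V_def E_def
    by (intro borel_measurable_add borel_measurable_diff grad_comp xA gA xSA) (use that in auto)
  have EP: "E t \<in> borel_measurable P" if "1 \<le> t" for t
    unfolding E_def by (intro borel_measurable_diff A_P[OF gA] grad_comp A_P[OF xA]) (use that in auto)
  note P_meas = A_P[OF xA] A_P[OF gA] A_P[OF xSA] A_P[OF xtA] A_P[OF VA]

  \<comment> \<open>Independence of the fresh sample\<close>
  have joint: "distr P ((borel \<Otimes>\<^sub>M borel) \<Otimes>\<^sub>M D) (\<lambda>\<omega>. ((x (t + 1) \<omega>, V t \<omega>), \<xi> (t + 1) \<omega>))
      = distr P (borel \<Otimes>\<^sub>M borel) (\<lambda>\<omega>. (x (t + 1) \<omega>, V t \<omega>)) \<Otimes>\<^sub>M distr P D (\<xi> (t + 1))"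
    if t: "1 \<le> t" for t
  proof (rule P.joint_distr_vimage_algebra)
    show "P.indep_var (PiM {1..t} (\<lambda>_. D)) (\<lambda>\<omega>. restrict (\<lambda>i. \<xi> i \<omega>) {1..t})
        (PiM {t + 1} (\<lambda>_. D)) (\<lambda>\<omega>. restrict (\<lambda>i. \<xi> i \<omega>) {t + 1})"
      by (rule P.indep_var_restrict[OF samples_indep]) auto
    show "(\<lambda>\<omega>. (x (t + 1) \<omega>, V t \<omega>)) \<in> vimage_algebra (space P) (\<lambda>\<omega>. restrict (\<lambda>i. \<xi> i \<omega>) {1..t})
        (PiM {1..t} (\<lambda>_. D)) \<rightarrow>\<^sub>M borel \<Otimes>\<^sub>M borel"
      using xSA[OF t] VA[OF t] unfolding A_def by (rule measurable_Pair)
    have "(\<lambda>\<omega>. restrict (\<lambda>i. \<xi> i \<omega>) {t + 1}) \<in> vimage_algebra (space P) (\<lambda>\<omega>. restrict (\<lambda>i. \<xi> i \<omega>) {t + 1})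
        (PiM {t + 1} (\<lambda>_. D)) \<rightarrow>\<^sub>M PiM {t + 1} (\<lambda>_. D)"
      using measurable_space[OF \<xi>P] by (intro measurable_vimage_algebra1) (auto simp: space_PiM)
    from measurable_compose[OF this measurable_component_singleton, of "t + 1"]
    show "\<xi> (t + 1) \<in> vimage_algebra (space P) (\<lambda>\<omega>. restrict (\<lambda>i. \<xi> i \<omega>) {t + 1})
        (PiM {t + 1} (\<lambda>_. D)) \<rightarrow>\<^sub>M D" by simp
  qed

  \<comment> \<open>Integrability from compactness\<close>
  obtain B where B: "\<And>y. y \<in> X \<Longrightarrow> norm y \<le> B"
    using compact_imp_bounded[OF X(2)] by (auto simp: bounded_iff)
  have dist_B: "norm (y - z) \<le> 2 * B" if "y \<in> X" "z \<in> X" for y z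
    using B[OF that(1)] B[OF that(2)] norm_triangle_ineq4[of y z] by linarith
  have d_int: "integrable P (\<lambda>\<omega>. norm (xt (t + 1) \<omega> - x t \<omega>))"
    "integrable P (\<lambda>\<omega>. (norm (xt (t + 1) \<omega> - x t \<omega>))\<^sup>2)" if t: "1 \<le> t" for t
  proof -
    have meas: "(\<lambda>\<omega>. xt (t + 1) \<omega> - x t \<omega>) \<in> borel_measurable P"
      by (intro borel_measurable_diff P_meas t)
    have bound: "norm (xt (t + 1) \<omega> - x t \<omega>) \<le> 2 * B" if "\<omega> \<in> space P" for \<omega>
      by (intro dist_B xtX xX t that)
    show "integrable P (\<lambda>\<omega>. norm (xt (t + 1) \<omega> - x t \<omega>))"
      by (rule P.integrable_const_bound[of _ "2 * B"]) (use meas bound in auto)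
    show "integrable P (\<lambda>\<omega>. (norm (xt (t + 1) \<omega> - x t \<omega>))\<^sup>2)"
      by (rule P.integrable_const_bound[of _ "(2 * B)\<^sup>2"]) (use meas power_mono[OF bound norm_ge_zero, of _ 2] in auto)
  qed
  obtain C where C: "\<And>y. y \<in> X \<Longrightarrow> norm (f y) \<le> C"
    using compact_imp_bounded[OF compact_continuous_image[OF f_cont X(2)]] by (auto simp: bounded_iff)
  have f_int: "integrable P (\<lambda>\<omega>. f (x t \<omega>))" if t: "1 \<le> t" for t
  proof (rule P.integrable_const_bound[of _ C])
    show "(\<lambda>\<omega>. f (x t \<omega>)) \<in> borel_measurable P"
      by (rule borel_measurable_continuous_on_range[OF f_cont]) (use P_meas[OF t] xX[OF t] in auto)
  qed (use C xX[OF t] in auto)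

  \<comment> \<open>Recursion for the mean squared error\<close>
  have V_le: "(norm (V t \<omega>))\<^sup>2 \<le> (1 + c * \<mu> t) * (norm (E t \<omega>))\<^sup>2
      + (1 + 1 / (c * \<mu> t)) * (L * \<mu> t)\<^sup>2 * (norm (xt (t + 1) \<omega> - x t \<omega>))\<^sup>2"
    if t: "1 \<le> t" and \<omega>: "\<omega> \<in> space P" for t \<omega>
  proof -
    define u where "u = gradient f (x t \<omega>) - gradient f (x (t + 1) \<omega>)"
    have "norm u \<le> L * norm (x t \<omega> - x (t + 1) \<omega>)"
      unfolding u_def using t \<omega> by (intro smooth xX) auto
    also have "x t \<omega> - x (t + 1) \<omega> = - \<mu> t *\<^sub>R (xt (t + 1) \<omega> - x t \<omega>)"
      using x_Suc[OF t \<omega>] by (simp add: algebra_simps)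
    finally have "norm u \<le> L * \<mu> t * norm (xt (t + 1) \<omega> - x t \<omega>)" using \<mu>0[of t] by simp
    then have "(norm u)\<^sup>2 \<le> (L * \<mu> t * norm (xt (t + 1) \<omega> - x t \<omega>))\<^sup>2" by (rule power_mono) simp
    then have u: "(norm u)\<^sup>2 \<le> (L * \<mu> t)\<^sup>2 * (norm (xt (t + 1) \<omega> - x t \<omega>))\<^sup>2"
      by (simp only: power_mult_distrib)
    have "V t \<omega> = E t \<omega> + u" by (simp add: V_def u_def)
    \<comment> \<open>The Young weight equals the averaging weight \<open>c * \<mu> t\<close>, so
      that the factor \<open>1 + c * \<mu> t\<close> is absorbed by
      \<open>(1 - c * \<mu> t)\<^sup>2\<close> later.\<close>
    moreover have "(norm (E t \<omega> + u))\<^sup>2 \<le> (1 + c * \<mu> t) * (norm (E t \<omega>))\<^sup>2 + (1 + 1 / (c * \<mu> t)) * (norm u)\<^sup>2"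
      by (rule norm_add_squared_Young) (use c0 \<mu>0[of t] in simp)
    moreover have "(1 + 1 / (c * \<mu> t)) * (norm u)\<^sup>2
        \<le> (1 + 1 / (c * \<mu> t)) * ((L * \<mu> t)\<^sup>2 * (norm (xt (t + 1) \<omega> - x t \<omega>))\<^sup>2)"
      by (rule mult_left_mono[OF u]) (use c0 \<mu>0[of t] in simp)
    ultimately show ?thesis by (simp add: mult.assoc)
  qed
  have V_int: "integrable P (\<lambda>\<omega>. (norm (V t \<omega>))\<^sup>2)"
    if t: "1 \<le> t" and E: "integrable P (\<lambda>\<omega>. (norm (E t \<omega>))\<^sup>2)" for t
    by (rule integrable_nonneg_bound[OF _ _ _ V_le[OF t]]) (use E d_int(2)[OF t] P_meas(5)[OF t] in auto)
  \<comment> \<open>Square integrability of the next error rests on that of the current one, so it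
    is proved together with the bound and then propagated by induction.\<close>
  have noise: "integrable P (\<lambda>\<omega>. (norm (E (t + 1) \<omega>))\<^sup>2)"
    "e (t + 1) \<le> (c * \<mu> t)\<^sup>2 * \<sigma>\<^sup>2 + (1 - c * \<mu> t)\<^sup>2 * P.expectation (\<lambda>\<omega>. (norm (V t \<omega>))\<^sup>2)"
    if t: "1 \<le> t" and E: "integrable P (\<lambda>\<omega>. (norm (E t \<omega>))\<^sup>2)" for t
  proof -
    note N = P.noise_second_moment[OF P_meas(3)[OF t] P_meas(5)[OF t] \<xi>P joint[OF t] samples_distr
        G_meas G_mean G_var V_int[OF t E], of "c * \<mu> t" "1 - c * \<mu> t"]
    show "integrable P (\<lambda>\<omega>. (norm (E (t + 1) \<omega>))\<^sup>2)"
      using N(1) t E_Suc[OF t] by (simp cong: Bochner_Integration.integrable_cong)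
    show "e (t + 1) \<le> (c * \<mu> t)\<^sup>2 * \<sigma>\<^sup>2 + (1 - c * \<mu> t)\<^sup>2 * P.expectation (\<lambda>\<omega>. (norm (V t \<omega>))\<^sup>2)"
      using N(2) t E_Suc[OF t] unfolding e_def by (simp cong: Bochner_Integration.integral_cong)
  qed
  \<comment> \<open>The starting point is deterministic and \<open>g 1\<close> is a single sampled
    gradient, so the variance assumption applies directly.\<close>
  have E1_int: "integrable P (\<lambda>\<omega>. (norm (E 1 \<omega>))\<^sup>2)" and e1: "e 1 \<le> \<sigma>\<^sup>2"
  proof -
    have "integrable (distr P D (\<xi> 1)) (\<lambda>s. (norm (G x1 s))\<^sup>2)"
      "(LINT s|distr P D (\<xi> 1). (norm (G x1 s))\<^sup>2) \<le> \<sigma>\<^sup>2"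
      using G_var samples_distr[of 1] by simp_all
    then have "integrable P (\<lambda>\<omega>. (norm (G x1 (\<xi> 1 \<omega>)))\<^sup>2)"
      "P.expectation (\<lambda>\<omega>. (norm (G x1 (\<xi> 1 \<omega>)))\<^sup>2) \<le> \<sigma>\<^sup>2"
      using borel_measurable_integrable[OF G_var(1)[of x1]]
      by (simp_all add: integrable_distr_eq integral_distr)
    then show "integrable P (\<lambda>\<omega>. (norm (E 1 \<omega>))\<^sup>2)" "e 1 \<le> \<sigma>\<^sup>2"
      unfolding e_def using E_1
      by (simp_all cong: Bochner_Integration.integrable_cong Bochner_Integration.integral_cong)
  qed
  have E_int: "integrable P (\<lambda>\<omega>. (norm (E t \<omega>))\<^sup>2)" if "1 \<le> t" for t
    using that by (induction t rule: dec_induct) (use E1_int noise(1) in auto)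
  have error: "e (t + 1) \<le> (1 - c * \<mu> t) * e t + L\<^sup>2 * \<mu> t / c * d t + (c * \<mu> t)\<^sup>2 * \<sigma>\<^sup>2" if t: "1 \<le> t" for t
  proof -
    define a where "a = c * \<mu> t"
    have a: "0 < a" "a \<le> 1" using c0 \<mu>0[of t] \<alpha>1[OF t] by (simp_all add: a_def)
    have ed: "0 \<le> e t" "0 \<le> d t" by (simp_all add: e_def d_def)
    have "P.expectation (\<lambda>\<omega>. (norm (V t \<omega>))\<^sup>2) \<le> P.expectation (\<lambda>\<omega>. (1 + a) * (norm (E t \<omega>))\<^sup>2
      + (1 + 1 / a) * (L * \<mu> t)\<^sup>2 * (norm (xt (t + 1) \<omega> - x t \<omega>))\<^sup>2)"
      unfolding a_def using V_le[OF t] V_int[OF t E_int[OF t]] E_int[OF t] d_int(2)[OF t]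
      by (intro integral_mono) auto
    also have "\<dots> = (1 + a) * e t + (1 + 1 / a) * (L * \<mu> t)\<^sup>2 * d t"
      using E_int[OF t] d_int(2)[OF t] by (simp add: e_def d_def)
    finally have "(1 - a)\<^sup>2 * P.expectation (\<lambda>\<omega>. (norm (V t \<omega>))\<^sup>2)
        \<le> (1 - a)\<^sup>2 * ((1 + a) * e t + (1 + 1 / a) * (L * \<mu> t)\<^sup>2 * d t)"
      by (rule mult_left_mono) simp
    \<comment> \<open>Both coefficients contain \<open>(1 - a) * (1 - a\<^sup>2)\<close>, the second
      one divided by \<open>a\<close>; this factor is at most \<open>1 - a\<close> and at most
      1.\<close>
    also have "\<dots> = ((1 - a) * (1 - a\<^sup>2)) * e t + ((1 - a) * (1 - a\<^sup>2)) * ((L * \<mu> t)\<^sup>2 / a * d t)"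
      using a(1) by (simp add: field_simps power2_eq_square)
    also have "\<dots> \<le> (1 - a) * e t + 1 * ((L * \<mu> t)\<^sup>2 / a * d t)"
    proof (intro add_mono mult_right_mono)
      have a2: "0 \<le> 1 - a\<^sup>2" "1 - a\<^sup>2 \<le> 1" using a by (simp_all add: power_le_one)
      show "(1 - a) * (1 - a\<^sup>2) \<le> 1 - a" using a a2 by (simp add: mult_left_le)
      then show "(1 - a) * (1 - a\<^sup>2) \<le> 1" using a by linarith
    qed (use ed a in auto)
    also have "(L * \<mu> t)\<^sup>2 / a = L\<^sup>2 * \<mu> t / c"
      using c0 \<mu>0[of t] by (simp add: a_def field_simps power2_eq_square)
    finally show ?thesis using noise(2)[OF t E_int[OF t]] by (simp add: a_def)
  qed

  \<comment> \<open>Descent of the mean objective\<close>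
  have descent: "\<phi> (t + 1) \<le> \<phi> t + \<mu> t * (\<gamma> / \<rho> * e t - 11 / 16 * (\<rho> / \<gamma>) * d t)" if t: "1 \<le> t" for t
  proof -
    have pw: "f (x (t + 1) \<omega>) \<le> f (x t \<omega>) + (\<mu> t * (\<gamma> / \<rho>) * (norm (E t \<omega>))\<^sup>2
        - \<mu> t * (11 / 16 * (\<rho> / \<gamma>)) * (norm (xt (t + 1) \<omega> - x t \<omega>))\<^sup>2)" if \<omega>: "\<omega> \<in> space P" for \<omega>
    proof -
      define u where "u = xt (t + 1) \<omega> - x t \<omega>"
      have dx: "x (t + 1) \<omega> - x t \<omega> = \<mu> t *\<^sub>R u" using x_Suc[OF t \<omega>] by (simp add: u_def algebra_simps)
      have "f (x (t + 1) \<omega>) \<le> f (x t \<omega>) + gradient f (x t \<omega>) \<bullet> (x (t + 1) \<omega> - x t \<omega>)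
          + L / 2 * (norm (x (t + 1) \<omega> - x t \<omega>))\<^sup>2"
        using t \<omega> by (intro smooth_upper_bound[OF f_diff U(1) X(3) U(2) _ _ smooth] xX) auto
      also have "\<dots> = f (x t \<omega>) + \<mu> t * (g t \<omega> \<bullet> u - E t \<omega> \<bullet> u + \<mu> t * L / 2 * (norm u)\<^sup>2)"
        unfolding dx using \<mu>0[of t]
        by (simp add: E_def inner_diff_left power_mult_distrib power2_eq_square algebra_simps)
      \<comment> \<open>The proximal step, Young's inequality and the smoothness term contribute -1,
        1/4 and 1/16 times \<open>\<rho> / \<gamma>\<close>, which sum to -11/16.\<close>
      also have "\<dots> \<le> f (x t \<omega>) + \<mu> t * (- (\<rho> / \<gamma>) * (norm u)\<^sup>2
          + (\<gamma> / \<rho> * (norm (E t \<omega>))\<^sup>2 + \<rho> / (4 * \<gamma>) * (norm u)\<^sup>2) + \<rho> / (16 * \<gamma>) * (norm u)\<^sup>2)"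
      proof -
        have "g t \<omega> \<bullet> u \<le> - (\<rho> / \<gamma>) * (norm u)\<^sup>2"
          unfolding u_def xt[OF t \<omega>]
          by (rule prox_step_descent[OF X xX[OF t \<omega>] Hsym[OF t \<omega>] H_ge[OF t \<omega>] \<gamma>(1)])
        moreover have "- (E t \<omega> \<bullet> u) \<le> \<gamma> / \<rho> * (norm (E t \<omega>))\<^sup>2 + \<rho> / (4 * \<gamma>) * (norm u)\<^sup>2"
          by (rule minus_inner_le_Young) (use \<rho> \<gamma> in auto)
        moreover have "\<mu> t * L / 2 * (norm u)\<^sup>2 \<le> \<rho> / (16 * \<gamma>) * (norm u)\<^sup>2"
        proof (rule mult_right_mono)
          \<comment> \<open>Here the upper bound on \<gamma> enters: it is equivalent to
            \<open>k / sqrt m \<le> \<rho> / (8 * L * \<gamma>)\<close>.\<close>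
          have "\<mu> t \<le> k / sqrt m"
            unfolding \<mu> using k m0 by (intro divide_left_mono) auto
          moreover have "k / sqrt m \<le> \<rho> / (8 * L * \<gamma>)"
            using \<gamma> L k m0 \<rho> by (simp add: field_simps)
          ultimately have "\<mu> t \<le> \<rho> / (8 * L * \<gamma>)" by linarith
          then show "\<mu> t * L / 2 \<le> \<rho> / (16 * \<gamma>)" using L \<gamma> by (simp add: field_simps)
        qed simp
        ultimately show ?thesis using \<mu>0[of t] by (intro add_left_mono mult_left_mono) linarith+
      qed
      also have "\<dots> = f (x t \<omega>) + (\<mu> t * (\<gamma> / \<rho>) * (norm (E t \<omega>))\<^sup>2 - \<mu> t * (11 / 16 * (\<rho> / \<gamma>)) * (norm u)\<^sup>2)"
        by (simp add: algebra_simps)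
      finally show ?thesis by (simp add: u_def)
    qed
    have "\<phi> (t + 1) \<le> P.expectation (\<lambda>\<omega>. f (x t \<omega>) + (\<mu> t * (\<gamma> / \<rho>) * (norm (E t \<omega>))\<^sup>2
        - \<mu> t * (11 / 16 * (\<rho> / \<gamma>)) * (norm (xt (t + 1) \<omega> - x t \<omega>))\<^sup>2))"
      unfolding \<phi>_def using pw f_int[OF t] f_int[of "t + 1"] E_int[OF t] d_int(2)[OF t]
      by (intro integral_mono) auto
    also have "\<dots> = \<phi> t + (\<mu> t * (\<gamma> / \<rho>) * e t - \<mu> t * (11 / 16 * (\<rho> / \<gamma>)) * d t)"
      using f_int[OF t] E_int[OF t] d_int(2)[OF t] by (simp add: \<phi>_def e_def d_def)
    finally show ?thesis by (simp add: algebra_simps)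
  qed
  have fstar_le: "fstar \<le> \<phi> t" if t: "1 \<le> t" for t
  proof -
    have "P.expectation (\<lambda>_. fstar) \<le> \<phi> t"
      unfolding \<phi>_def using f_int[OF t] xX[OF t] f_bdd
      by (intro integral_mono) (auto simp: fstar intro: cINF_lower)
    then show ?thesis by (simp add: P.prob_space)
  qed
  have \<phi>1: "\<phi> 1 = f x1"
    unfolding \<phi>_def using x1(1) by (simp cong: Bochner_Integration.integral_cong add: P.prob_space)
  have rate: "(\<Sum>t=1..T. e t / \<rho>\<^sup>2 + d t / \<gamma>\<^sup>2) \<le> 2 * M * sqrt (m + real T)"
    by (rule potential_rate[OF \<rho> L k m \<gamma>(1) c \<mu> descent error e1 _ _ fstar_le T])
       (simp_all add: e_def d_def M \<phi>1[unfolded One_nat_def])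

  \<comment> \<open>Convergence measure and gradient mapping\<close>
  define CM where "CM = (\<lambda>t \<omega>. convergence_measure \<rho> \<gamma> f (x t \<omega>) (g t \<omega>) (xt (t + 1) \<omega>))"
  define GM where "GM = (\<lambda>t \<omega>. norm (gradient_mapping X (H t \<omega>) (x t \<omega>) (gradient f (x t \<omega>)) \<gamma>))"
  have CM: "CM t \<omega> = norm (E t \<omega>) / \<rho> + norm (xt (t + 1) \<omega> - x t \<omega>) / \<gamma>" for t \<omega>
    by (simp add: CM_def convergence_measure_def E_def norm_minus_commute)
  have CM_sq: "(CM t \<omega>)\<^sup>2 \<le> 2 / \<rho>\<^sup>2 * (norm (E t \<omega>))\<^sup>2 + 2 / \<gamma>\<^sup>2 * (norm (xt (t + 1) \<omega> - x t \<omega>))\<^sup>2" for t \<omega>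
    using sum_squares_bound[of "norm (E t \<omega>) / \<rho>" "norm (xt (t + 1) \<omega> - x t \<omega>) / \<gamma>"]
    by (simp add: CM power2_sum power_divide)
  have CM_int: "integrable P (CM t)" "integrable P (\<lambda>\<omega>. (CM t \<omega>)\<^sup>2)" if t: "1 \<le> t" for t
  proof -
    note [measurable] = P_meas[OF t] EP[OF t]
    have [measurable]: "CM t \<in> borel_measurable P" unfolding CM by measurable
    show sq: "integrable P (\<lambda>\<omega>. (CM t \<omega>)\<^sup>2)"
      by (rule integrable_nonneg_bound[OF _ _ _ CM_sq]) (use E_int[OF t] d_int(2)[OF t] in auto)
    show "integrable P (CM t)" by (rule P.square_integrable_imp_integrable[OF _ sq]) measurable
  qed
  have CM_exp: "(P.expectation (CM t))\<^sup>2 \<le> 2 * (e t / \<rho>\<^sup>2 + d t / \<gamma>\<^sup>2)" if t: "1 \<le> t" for t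
  proof -
    \<comment> \<open>Jensen's inequality for the square, read off from nonnegativity of the
      variance.\<close>
    have "(P.expectation (CM t))\<^sup>2 \<le> P.expectation (\<lambda>\<omega>. (CM t \<omega>)\<^sup>2)"
      using P.variance_positive[of "CM t"] P.variance_eq[OF CM_int[OF t]] by simp
    also have "\<dots> \<le> P.expectation (\<lambda>\<omega>. 2 / \<rho>\<^sup>2 * (norm (E t \<omega>))\<^sup>2
        + 2 / \<gamma>\<^sup>2 * (norm (xt (t + 1) \<omega> - x t \<omega>))\<^sup>2)"
      using CM_sq CM_int[OF t] E_int[OF t] d_int(2)[OF t] by (intro integral_mono) auto
    also have "\<dots> = 2 / \<rho>\<^sup>2 * e t + 2 / \<gamma>\<^sup>2 * d t"
      using E_int[OF t] d_int(2)[OF t] by (simp add: e_def d_def)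
    finally show ?thesis by simp
  qed
  have GM_CM: "GM t \<omega> \<le> CM t \<omega>" if t: "1 \<le> t" and \<omega>: "\<omega> \<in> space P" for t \<omega>
  proof -
    let ?y = "prox_step X \<gamma> (H t \<omega>) (x t \<omega>) (gradient f (x t \<omega>))"
    \<comment> \<open>The two proximal steps share \<open>H t\<close> and the centre and differ only
      in the gradient, so the perturbation bound reduces to the estimator error.\<close>
    have "norm (?y - xt (t + 1) \<omega>) \<le> \<gamma> / \<rho> * norm (E t \<omega>)"
      using prox_step_perturbation[OF X Hsym[OF t \<omega>] H_ge[OF t \<omega>] Hsym[OF t \<omega>] \<gamma>(1) \<rho>,
          of "x t \<omega>" "gradient f (x t \<omega>)" "x t \<omega>" "g t \<omega>"]
      unfolding xt[OF t \<omega>] E_def by simp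
    then have "norm (x t \<omega> - ?y) \<le> \<gamma> / \<rho> * norm (E t \<omega>) + norm (xt (t + 1) \<omega> - x t \<omega>)"
      using norm_triangle_ineq[of "?y - xt (t + 1) \<omega>" "xt (t + 1) \<omega> - x t \<omega>"]
      by (simp add: norm_minus_commute[of "x t \<omega>" ?y])
    then have "(1 / \<gamma>) * norm (x t \<omega> - ?y) \<le> (1 / \<gamma>) * (\<gamma> / \<rho> * norm (E t \<omega>) + norm (xt (t + 1) \<omega> - x t \<omega>))"
      using \<gamma> by (intro mult_left_mono) auto
    then show ?thesis
      using \<gamma> by (simp add: GM_def CM gradient_mapping_def distrib_left)
  qed
  have GM_int: "integrable P (GM t)" if t: "1 \<le> t" for t
  proof (rule integrable_nonneg_bound[OF CM_int(1)[OF t] _ _ GM_CM[OF t]])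
    have "(\<lambda>\<omega>. prox_step X \<gamma> (H t \<omega>) (x t \<omega>) (gradient f (x t \<omega>))) \<in> borel_measurable P"
      by (rule A_P[OF prox_meas[OF t xA[OF t] grad_comp[OF xA[OF t]]]]) (use t in auto)
    then show "GM t \<in> borel_measurable P"
      unfolding GM_def gradient_mapping_def using P_meas(1)[OF t] by measurable
  qed (simp add: GM_def)
  have "1 / real T * (\<Sum>t=1..T. P.expectation (GM t)) \<le> 1 / real T * (\<Sum>t=1..T. P.expectation (CM t))"
    using GM_CM GM_int CM_int(1) by (intro mult_left_mono sum_mono integral_mono) auto
  moreover have "1 / real T * (\<Sum>t=1..T. P.expectation (CM t))
      \<le> 2 * sqrt (2 * M) * m powr (1/4) / sqrt (real T) + 2 * sqrt (2 * M) / real T powr (1/4)"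
  proof (rule average_le_of_sum_squares[OF T])
    \<comment> \<open>The factor 2 from squaring the two-term measure turns the \<open>2 * M\<close>
      of the rate into \<open>4 * M\<close>.\<close>
    have "(\<Sum>t=1..T. (P.expectation (CM t))\<^sup>2) \<le> (\<Sum>t=1..T. 2 * (e t / \<rho>\<^sup>2 + d t / \<gamma>\<^sup>2))"
      by (intro sum_mono CM_exp) auto
    also have "\<dots> \<le> 4 * M * sqrt (m + real T)"
      using rate by (simp only: sum_distrib_left[symmetric])
    finally show "(\<Sum>t=1..T. (P.expectation (CM t))\<^sup>2) \<le> 4 * M * sqrt (m + real T)" .
  qed (use m0 in simp)
  ultimately show ?thesis
    using GM_int CM_int(1) unfolding GM_def CM_def by auto
qed

end
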